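(* Let $T$ be a connected simple graph satisfying property $\mathcal{P}$. Let $2\leq m\leq\chi(T)$, $r\geq 1$, $0\leq i\leq r-1$ and $A=\{0,\ldots,i\}$. Then $$\chi(K_m^{T_A^r})=\mathrm{conn}(\mathcal{N}(K_m^{T_A^r}))+3.$$
   Context: All graphs are finite, undirected, without multiple edges; loops are allowed unless the graph is called simple (no loops). $E(G)\subseteq V(G)\times V(G)$ is the symmetric edge relation, and $x \sim y$ means $(x,y)\in E(G)$. $K_n$ is the complete graph on $\{1,\dots,n\}$ (no loops). The chromatic number $\chi(G)$ of a simple graph $G$ is the least $n$ such that there is a graph homomorphism (edge-preserving vertex map) $G\to K_n$. Property $\mathcal{P}$: a simple graph $G$ satisfies $\mathcal{P}$ if for any two edges $(v_1,w_1)$ and $(v_2,w_2)$ of $G$ with $\{v_1,w_1\}\cap\{v_2,w_2\}=\emptyset$, if $(v_2,v_1)\in E(G)$ then $(w_2,v_1)\in E(G)$ or $(w_2,w_1)\in E(G)$. Categorical product: $G\times H$ has vertex set $V(G)\times V(H)$, with $(g,h)\sim(g',h')$ iff $g\sim g'$ in $G$ and $h\sim h'$ in $H$. For $r\ge1$, $L_r$ is the path with vertex set $\{0,\dots,r\}$ and edges $i\sim i+1$ for $0\le i\le r-1$. For $A\subseteq\{0,\dots,r\}$, $L_r(A)$ is $L_r$ with a loop added at each $x\in A$. For a graph $G$, $G_A^r=(G\times L_r(A))/\sim_r$, where $\sim_r$ identifies all vertices whose second coordinate is $r$ to a single vertex (two vertices of the quotient are adjacent iff some representatives are adjacent). Exponential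 graph: $H^G$ has as vertices all set maps $V(G)\to V(H)$, and $f\sim f'$ in $H^G$ iff $v\sim v'$ in $G$ implies $f(v)\sim f'(v')$ in $H$. Neighborhood complex: $\mathcal{N}(G)$ is the simplicial complex whose simplices are the subsets $A\subseteq V(G)$ having a common neighbor (some $x$ with $(x,a)\in E(G)$ for all $a\in A$), regarded as a topological space via its geometric realization. A space $X$ is $k$-connected if for all $0\le j\le k$ every continuous map $\mathbb{S}^j\to X$ extends to the ball $\mathbb{B}^{j+1}$; $\mathrm{conn}(X)$ is the largest $k$ such that $X$ is $k$-connected, and it is $-1$ for a nonempty disconnected space. *)

theory Defs
  imports "HOL-Analysis.Analysis" "Graph_Theory.Digraph_Component"
begin

text \<open>
  A finite undirected graph, possibly with loops, is a \<open>pair_pseudo_graph\<close> (finite vertex set,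
  symmetric arc relation on it); a finite simple graph is a \<open>pair_graph\<close> (additionally no loops).
\<close>

definition graph_hom :: "'a pair_pre_digraph \<Rightarrow> 'b pair_pre_digraph \<Rightarrow> ('a \<Rightarrow> 'b) \<Rightarrow> bool" where
  "graph_hom G H f \<longleftrightarrow>
     f \<in> pverts G \<rightarrow> pverts H \<and> (\<forall>(x, y) \<in> parcs G. (f x, f y) \<in> parcs H)"

definition complete_graph :: "nat \<Rightarrow> nat pair_pre_digraph" where
  "complete_graph n =
     \<lparr> pverts = {1..n}, parcs = {(x, y). x \<in> {1..n} \<and> y \<in> {1..n} \<and> x \<noteq> y} \<rparr>"

text \<open>Only meaningful for finite simple graphs: if \<open>G\<close> has a loop, no such \<open>n\<close> exists.\<close>

definition chromatic_number :: "'a pair_pre_digraph \<Rightarrow> nat" where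
  "chromatic_number G = (LEAST n. \<exists>f. graph_hom G (complete_graph n) f)"

definition property_P :: "'a pair_pre_digraph \<Rightarrow> bool" where
  "property_P G \<longleftrightarrow>
     (\<forall>v1 w1 v2 w2.
        (v1, w1) \<in> parcs G \<longrightarrow> (v2, w2) \<in> parcs G \<longrightarrow> {v1, w1} \<inter> {v2, w2} = {} \<longrightarrow>
        (v2, v1) \<in> parcs G \<longrightarrow> (w2, v1) \<in> parcs G \<or> (w2, w1) \<in> parcs G)"

definition categorical_product ::
  "'a pair_pre_digraph \<Rightarrow> 'b pair_pre_digraph \<Rightarrow> ('a \<times> 'b) pair_pre_digraph" where
  "categorical_product G H =
     \<lparr> pverts = pverts G \<times> pverts H,
       parcs = {((g, h), (g', h')). (g, g') \<in> parcs G \<and> (h, h') \<in> parcs H} \<rparr>"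

text \<open>The path on \<open>{0..r}\<close> with a loop added at each element of \<open>A \<subseteq> {0..r}\<close>.\<close>

definition looped_path :: "nat \<Rightarrow> nat set \<Rightarrow> nat pair_pre_digraph" where
  "looped_path r A =
     \<lparr> pverts = {0..r},
       parcs = {(i, j). i \<in> {0..r} \<and> j \<in> {0..r} \<and> (j = i + 1 \<or> i = j + 1)} \<union> {(x, x) | x. x \<in> A} \<rparr>"

text \<open>\<open>R\<close> is an equivalence relation on \<open>pverts G\<close>; the vertices of the quotient are its classes.\<close>

definition quotient_graph :: "'a pair_pre_digraph \<Rightarrow> 'a rel \<Rightarrow> 'a set pair_pre_digraph" where
  "quotient_graph G R =
     \<lparr> pverts = pverts G // R,
       parcs = {(X, Y). X \<in> pverts G // R \<and> Y \<in> pverts G // R \<and>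
                        (\<exists>x\<in>X. \<exists>y\<in>Y. (x, y) \<in> parcs G)} \<rparr>"

definition top_level_rel :: "('a \<times> nat) set \<Rightarrow> nat \<Rightarrow> ('a \<times> nat) rel" where
  "top_level_rel V r = {(x, y). x \<in> V \<and> y \<in> V \<and> (x = y \<or> (snd x = r \<and> snd y = r))}"

definition cone_graph ::
  "'a pair_pre_digraph \<Rightarrow> nat \<Rightarrow> nat set \<Rightarrow> ('a \<times> nat) set pair_pre_digraph" where
  "cone_graph G r A =
     quotient_graph (categorical_product G (looped_path r A))
       (top_level_rel (pverts (categorical_product G (looped_path r A))) r)"

text \<open>
  The graph \<open>H\<close> to the power \<open>G\<close>. Vertices are extensional functions, so that
  they correspond one-to-one to set maps from \<open>pverts G\<close> to \<open>pverts H\<close>.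
\<close>

definition exponential_graph ::
  "'b pair_pre_digraph \<Rightarrow> 'a pair_pre_digraph \<Rightarrow> ('a \<Rightarrow> 'b) pair_pre_digraph" where
  "exponential_graph H G =
     \<lparr> pverts = pverts G \<rightarrow>\<^sub>E pverts H,
       parcs = {(f, f'). f \<in> pverts G \<rightarrow>\<^sub>E pverts H \<and> f' \<in> pverts G \<rightarrow>\<^sub>E pverts H \<and>
                         (\<forall>(v, v') \<in> parcs G. (f v, f' v') \<in> parcs H)} \<rparr>"

text \<open>An abstract simplicial complex is given by its set of simplices.\<close>

definition neighborhood_complex :: "'a pair_pre_digraph \<Rightarrow> 'a set set" where
  "neighborhood_complex G =
     {A. A \<subseteq> pverts G \<and> (\<exists>x \<in> pverts G. \<forall>a\<in>A. (x, a) \<in> parcs G)}"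

text \<open>
  Geometric realization of a complex with finite vertex set \<open>\<Union>K\<close>: the points are the families of
  barycentric coordinates whose support is a simplex, with the subspace topology from
  \<open>\<real>\<close> to the power \<open>\<Union>K\<close> (for infinite complexes this would not be the weak topology).
\<close>

definition geometric_realization :: "'a set set \<Rightarrow> ('a \<Rightarrow> real) topology" where
  "geometric_realization K =
     subtopology (powertop_real (\<Union>K))
       {t. (\<forall>v\<in>\<Union>K. 0 \<le> t v) \<and> (\<Sum>v\<in>\<Union>K. t v) = 1 \<and> {v\<in>\<Union>K. t v \<noteq> 0} \<in> K}"

text \<open>The closed unit ball of dimension \<open>n\<close>; the boundary of \<open>nball (Suc j)\<close> is \<open>nsphere j\<close>.\<close>

definition nball :: "nat \<Rightarrow> (nat \<Rightarrow> real) topology" where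
  "nball n = subtopology (Euclidean_space n) {x. (\<Sum>i<n. x i ^ 2) \<le> 1}"

definition k_connected :: "int \<Rightarrow> 'a topology \<Rightarrow> bool" where
  "k_connected k X \<longleftrightarrow>
     (\<forall>j::nat. int j \<le> k \<longrightarrow>
       (\<forall>f. continuous_map (nsphere j) X f \<longrightarrow>
         (\<exists>g. continuous_map (nball (Suc j)) X g \<and> (\<forall>x \<in> topspace (nsphere j). g x = f x))))"

text \<open>
  The largest \<open>k\<close> such that \<open>X\<close> is \<open>k\<close>-connected, and \<open>\<infinity>\<close> if \<open>X\<close> is \<open>k\<close>-connected for every \<open>k\<close>.
  Every space is (-1)-connected, so the value is at least -1, and it is -1 if \<open>X\<close> is
  not path-connected.
\<close>

definition conn :: "'a topology \<Rightarrow> ereal" where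
  "conn X = Sup {ereal (of_int k) | k. k_connected k X}"

end

theory Submission
  imports Defs "HOL-Homology.Brouwer_Degree"
begin

text \<open>
  A connected graph with property \<open>P\<close> is complete multipartite: along a walk, the property carries
  adjacency to one of the two ends of a given edge from each vertex to the next, so that every edge
  dominates all vertices (\<open>property_P_edge_dominates\<close>). A maximal clique then yields a proper
  colouring, so \<open>T\<close> contains a clique with \<open>m\<close> vertices (\<open>clique_of_edge_dominating\<close>).

  Write \<open>H\<close> for the exponential graph and view its vertices as colourings of the levels of the cone
  with \<open>m\<close> colours. If \<open>f\<close> has a neighbour in \<open>H\<close>, then \<open>f\<close> is not a proper colouring of \<open>T\<close> on any
  level: proper colourings are so rigid in the presence of the clique that a neighbour of \<open>f\<close> would
  have to repeat the same colouring on the next level, and so on up to the apex, where all colours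
  agree (\<open>level_not_proper\<close>). So on every level \<open>f\<close> has a monochromatic edge, and its colour is seen
  by every vertex of \<open>T\<close>, because the edge dominates. Replacing each level of \<open>f\<close> by such a colour
  can only enlarge the neighbourhood of \<open>f\<close> (\<open>fold_to_levelwise\<close>). What remains is a colouring of the
  looped path, and this path folds step by step onto its looped vertex \<open>0\<close>.

  Two consequences follow. The colour on level \<open>0\<close> is a proper colouring of \<open>H\<close>, and the constant maps
  form a clique with \<open>m\<close> vertices, so the chromatic number is \<open>m\<close>. Moreover the foldings are
  contiguous to each other as maps of the neighborhood complex, so that the identity of that complex
  is homotopic to the composition of a map \<open>\<pi>\<close> to the neighborhood complex of the complete graph
  and a map \<open>\<iota>\<close> back (\<open>id_homotopic_const_col\<close>), and \<open>\<pi> \<circ> \<iota>\<close> is the identity. The neighborhood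
  complex of the complete graph is the boundary of a simplex with \<open>m\<close> vertices, a sphere of dimension
  \<open>m - 2\<close>. Hence the connectivity is \<open>m - 3\<close>:

  \<^item> It is at least \<open>m - 3\<close>, because a map from a sphere of dimension below \<open>m - 2\<close> to the
    boundary of the simplex is null-homotopic. Such a map is homotopic to a Lipschitz map
    (\<open>homotopic_lipschitz_map\<close>), a Lipschitz map between these dimensions is not surjective, by
    counting the cells of a fine grid (\<open>lipschitz_sphere_map_misses_point\<close>), and the boundary of a
    simplex minus a point is contractible.
  \<^item> It is not more, because otherwise \<open>\<iota>\<close> on the sphere of dimension \<open>m - 2\<close> would extend to the
    ball, and composing with \<open>\<pi>\<close> would extend the identity of that sphere to the ball.
\<close>

section \<open>Homotopies between maps of simplicial complexes\<close>

lemma topspace_geometric_realization: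
  "topspace (geometric_realization K) =
     {t \<in> extensional (\<Union>K). (\<forall>v\<in>\<Union>K. 0 \<le> t v) \<and> (\<Sum>v\<in>\<Union>K. t v) = 1 \<and> {v\<in>\<Union>K. t v \<noteq> 0} \<in> K}"
  by (auto simp: geometric_realization_def PiE_def)

lemma continuous_map_into_geometric_realization:
  "continuous_map X (geometric_realization K) f \<longleftrightarrow>
     f \<in> topspace X \<rightarrow> topspace (geometric_realization K) \<and>
     (\<forall>v\<in>\<Union>K. continuous_map X euclideanreal (\<lambda>x. f x v))"
  unfolding topspace_geometric_realization
  unfolding geometric_realization_def continuous_map_in_subtopology continuous_map_componentwise
  by (auto simp: Pi_iff)

lemma continuous_map_geometric_realization_coordinate:
  assumes "v \<in> \<Union>K"
  shows "continuous_map (geometric_realization K) euclideanreal (\<lambda>t. t v)"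
  unfolding geometric_realization_def
  using assms by (blast intro: continuous_map_from_subtopology continuous_map_product_projection)

text \<open>
  If the supports of two points lie in a common simplex, the segment between the points stays in that
  simplex.
\<close>

lemma homotopic_with_straight_line_realization:
  assumes down: "\<And>A B. A \<in> K \<Longrightarrow> B \<subseteq> A \<Longrightarrow> B \<in> K"
    and f: "continuous_map X (geometric_realization K) f"
    and g: "continuous_map X (geometric_realization K) g"
    and carrier: "\<And>x. x \<in> topspace X \<Longrightarrow> {v\<in>\<Union>K. f x v \<noteq> 0 \<or> g x v \<noteq> 0} \<in> K"
  shows "homotopic_with (\<lambda>_. True) X (geometric_realization K) f g"
proof -
  define h where "h = (\<lambda>(s::real, x). \<lambda>v\<in>\<Union>K. (1 - s) * f x v + s * g x v)"
  have fx: "f x \<in> topspace (geometric_realization K)" and gx: "g x \<in> topspace (geometric_realization K)"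
    if "x \<in> topspace X" for x
    using f g that by (auto simp: continuous_map_def)
  have mem: "h (s, x) \<in> topspace (geometric_realization K)" if "x \<in> topspace X" "0 \<le> s" "s \<le> 1" for s x
  proof -
    have "(\<Sum>v\<in>\<Union>K. h (s, x) v) = (1 - s) * (\<Sum>v\<in>\<Union>K. f x v) + s * (\<Sum>v\<in>\<Union>K. g x v)"
      by (simp add: h_def sum.distrib sum_distrib_left)
    also have "\<dots> = 1"
      using fx[OF that(1)] gx[OF that(1)] by (simp add: topspace_geometric_realization)
    finally have "(\<Sum>v\<in>\<Union>K. h (s, x) v) = 1" .
    moreover have "{v\<in>\<Union>K. h (s, x) v \<noteq> 0} \<in> K"
      by (rule down[OF carrier[OF that(1)]]) (auto simp: h_def)
    moreover have "\<forall>v\<in>\<Union>K. 0 \<le> h (s, x) v"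
      using fx[OF that(1)] gx[OF that(1)] that by (auto simp: topspace_geometric_realization h_def)
    moreover have "h (s, x) \<in> extensional (\<Union>K)"
      by (simp add: h_def)
    ultimately show ?thesis
      by (simp add: topspace_geometric_realization)
  qed
  have cont: "continuous_map (prod_topology (top_of_set {0..1}) X) euclideanreal (\<lambda>p. h p v)" if v: "v \<in> \<Union>K" for v
  proof -
    have "continuous_map X euclideanreal (\<lambda>x. f x v)" "continuous_map X euclideanreal (\<lambda>x. g x v)"
      using f g v by (auto simp: continuous_map_into_geometric_realization)
    then have 1: "continuous_map (prod_topology (top_of_set {0..1::real}) X) euclideanreal (\<lambda>p. f (snd p) v)"
      "continuous_map (prod_topology (top_of_set {0..1::real}) X) euclideanreal (\<lambda>p. g (snd p) v)"
      using continuous_map_compose[OF continuous_map_snd] by (auto simp: o_def)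
    have 2: "continuous_map (prod_topology (top_of_set {0..1}) X) euclideanreal fst"
      by (rule continuous_map_into_fulltopology[OF continuous_map_fst])
    have "(\<lambda>p. h p v) = (\<lambda>p. (1 - fst p) * f (snd p) v + fst p * g (snd p) v)"
      using v by (simp add: h_def fun_eq_iff case_prod_unfold del: Union_iff)
    then show ?thesis
      by (auto intro!: continuous_intros 1 2)
  qed
  have h: "continuous_map (prod_topology (top_of_set {0..1}) X) (geometric_realization K) h"
    unfolding continuous_map_into_geometric_realization
    using mem cont by auto
  have ends: "h (0, x) = f x" "h (1, x) = g x" if "x \<in> topspace X" for x
    using fx[OF that] gx[OF that]
    by (auto simp: h_def topspace_geometric_realization extensional_def fun_eq_iff)
  show ?thesis
    by (rule iffD2[OF homotopic_with], rule refl, intro exI[of _ h] conjI ballI TrueI)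
      (simp_all add: h ends)
qed

definition realization_map :: "'a set set \<Rightarrow> 'b set set \<Rightarrow> ('a \<Rightarrow> 'b) \<Rightarrow> ('a \<Rightarrow> real) \<Rightarrow> 'b \<Rightarrow> real" where
  "realization_map K L \<phi> t = (\<lambda>w\<in>\<Union>L. \<Sum>v\<in>{v \<in> \<Union>K. \<phi> v = w}. t v)"

lemma realization_map_support:
  assumes "t \<in> topspace (geometric_realization K)"
  shows "{w\<in>\<Union>L. realization_map K L \<phi> t w \<noteq> 0} \<subseteq> \<phi> ` {v\<in>\<Union>K. t v \<noteq> 0}"
proof
  fix w assume "w \<in> {w\<in>\<Union>L. realization_map K L \<phi> t w \<noteq> 0}"
  then have "(\<Sum>v | v \<in> \<Union>K \<and> \<phi> v = w. t v) \<noteq> 0"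
    by (auto simp: realization_map_def simp del: Union_iff split: if_splits)
  then obtain v where "v \<in> \<Union>K" "\<phi> v = w" "t v \<noteq> 0"
    by (metis (mono_tags, lifting) mem_Collect_eq sum.neutral)
  then show "w \<in> \<phi> ` {v\<in>\<Union>K. t v \<noteq> 0}"
    by auto
qed

lemma continuous_map_realization_map:
  assumes fin: "finite (\<Union>K)" "finite (\<Union>L)"
    and down: "\<And>A B. A \<in> L \<Longrightarrow> B \<subseteq> A \<Longrightarrow> B \<in> L"
    and simp: "\<And>A. A \<in> K \<Longrightarrow> \<phi> ` A \<in> L"
  shows "continuous_map (geometric_realization K) (geometric_realization L) (realization_map K L \<phi>)"
proof -
  have "realization_map K L \<phi> t \<in> topspace (geometric_realization L)"
    if t: "t \<in> topspace (geometric_realization K)" for t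
  proof -
    have im: "\<phi> ` \<Union>K \<subseteq> \<Union>L"
      using simp by blast
    have "(\<Sum>w\<in>\<Union>L. realization_map K L \<phi> t w) = (\<Sum>w\<in>\<Union>L. \<Sum>v | v \<in> \<Union>K \<and> \<phi> v = w. t v)"
      by (simp add: realization_map_def)
    also have "\<dots> = (\<Sum>v\<in>\<Union>K. t v)"
      by (rule sum.group[OF fin im])
    finally have "(\<Sum>w\<in>\<Union>L. realization_map K L \<phi> t w) = 1"
      using t by (simp add: topspace_geometric_realization)
    moreover have "{w\<in>\<Union>L. realization_map K L \<phi> t w \<noteq> 0} \<in> L"
      using t by (intro down[OF _ realization_map_support[OF t]] simp) (simp add: topspace_geometric_realization)
    moreover have "\<forall>w\<in>\<Union>L. 0 \<le> realization_map K L \<phi> t w"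
      using t by (auto simp: topspace_geometric_realization realization_map_def intro!: sum_nonneg)
    ultimately show ?thesis
      by (simp add: topspace_geometric_realization) (simp add: realization_map_def)
  qed
  moreover have "continuous_map (geometric_realization K) euclideanreal (\<lambda>t. realization_map K L \<phi> t w)" if "w \<in> \<Union>L" for w
    using that fin(1)
    by (auto simp: realization_map_def simp del: Union_iff intro!: continuous_intros continuous_map_geometric_realization_coordinate)
  ultimately show ?thesis
    by (auto simp: continuous_map_into_geometric_realization)
qed

text \<open>
  For each point of the source, contiguity provides one simplex of \<open>L\<close> that contains both images, and
  segments in this simplex form the homotopy.
\<close>

lemma homotopic_with_contiguous:
  assumes fin: "finite (\<Union>K)" "finite (\<Union>L)"
    and down: "\<And>A B. A \<in> L \<Longrightarrow> B \<subseteq> A \<Longrightarrow> B \<in> L"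
    and contig: "\<And>A. A \<in> K \<Longrightarrow> \<phi> ` A \<union> \<psi> ` A \<in> L"
  shows "homotopic_with (\<lambda>_. True) (geometric_realization K) (geometric_realization L)
           (realization_map K L \<phi>) (realization_map K L \<psi>)"
proof (rule homotopic_with_straight_line_realization)
  have "\<phi> ` A \<in> L" "\<psi> ` A \<in> L" if "A \<in> K" for A
    using down[OF contig[OF that]] by auto
  then show "continuous_map (geometric_realization K) (geometric_realization L) (realization_map K L \<phi>)"
    "continuous_map (geometric_realization K) (geometric_realization L) (realization_map K L \<psi>)"
    using fin down by (auto intro!: continuous_map_realization_map)
  fix t assume t: "t \<in> topspace (geometric_realization K)"
  let ?A = "{v\<in>\<Union>K. t v \<noteq> 0}"
  have "\<phi> ` ?A \<union> \<psi> ` ?A \<in> L"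
    using t by (intro contig) (simp add: topspace_geometric_realization)
  moreover have "{w\<in>\<Union>L. realization_map K L \<phi> t w \<noteq> 0 \<or> realization_map K L \<psi> t w \<noteq> 0}
      \<subseteq> \<phi> ` ?A \<union> \<psi> ` ?A"
    using Un_mono[OF realization_map_support[OF t, of L \<phi>] realization_map_support[OF t, of L \<psi>]]
    by (simp add: Collect_disj_eq conj_disj_distribL del: Union_iff disj_not1)
  ultimately show "{w\<in>\<Union>L. realization_map K L \<phi> t w \<noteq> 0 \<or> realization_map K L \<psi> t w \<noteq> 0} \<in> L"
    by (rule down)
qed (rule down)

lemma realization_map_compose:
  assumes "finite (\<Union>K)" "finite (\<Union>L)" and "\<phi> ` \<Union>K \<subseteq> \<Union>L"
  shows "realization_map L M \<psi> (realization_map K L \<phi> t) = realization_map K M (\<psi> \<circ> \<phi>) t"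
proof -
  have "(\<Sum>w | w \<in> \<Union>L \<and> \<psi> w = u. realization_map K L \<phi> t w) = (\<Sum>v | v \<in> \<Union>K \<and> \<psi> (\<phi> v) = u. t v)" for u
  proof -
    have "(\<Sum>w | w \<in> \<Union>L \<and> \<psi> w = u. realization_map K L \<phi> t w)
      = (\<Sum>w\<in>{w \<in> \<Union>L. \<psi> w = u}. \<Sum>v | v \<in> {v \<in> \<Union>K. \<psi> (\<phi> v) = u} \<and> \<phi> v = w. t v)"
      by (rule sum.cong) (auto simp: realization_map_def intro!: sum.cong)
    also have "\<dots> = (\<Sum>v\<in>{v \<in> \<Union>K. \<psi> (\<phi> v) = u}. t v)"
      using assms by (intro sum.group) (auto simp del: Union_iff)
    finally show ?thesis by simp
  qed
  then show ?thesis
    by (simp add: realization_map_def[of L M] realization_map_def[of K M] del: Union_iff)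
qed

lemma realization_map_cong_id:
  assumes "finite (\<Union>K)" "\<And>v. v \<in> \<Union>K \<Longrightarrow> \<phi> v = v" and t: "t \<in> topspace (geometric_realization K)"
  shows "realization_map K K \<phi> t = t"
proof
  fix w
  show "realization_map K K \<phi> t w = t w"
  proof (cases "w \<in> \<Union>K")
    case True
    have "v \<in> \<Union>K \<and> \<phi> v = w \<longleftrightarrow> v = w" for v
      using True assms(2)[of v] by (cases "v \<in> \<Union>K") (simp_all del: Union_iff, metis)
    then have "{v. v \<in> \<Union>K \<and> \<phi> v = w} = {w}"
      by (simp del: Union_iff)
    then show ?thesis
      using True by (simp add: realization_map_def)
  next
    case False
    then show ?thesis
      using t by (auto simp: realization_map_def topspace_geometric_realization extensional_def)
  qed
qed

lemma topspace_nball: "topspace (nball n) = {x. (\<forall>i\<ge>n. x i = 0) \<and> (\<Sum>i<n. x i ^ 2) \<le> 1}"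
  by (auto simp: nball_def topspace_Euclidean_space)

lemma topspace_nsphere: "topspace (nsphere n) = {x. (\<forall>i>n. x i = 0) \<and> (\<Sum>i\<le>n. x i ^ 2) = 1}"
  by (auto simp: nsphere)

lemma nball_eq: "nball n = subtopology (powertop_real UNIV) {x. (\<forall>i\<ge>n. x i = 0) \<and> (\<Sum>i<n. x i ^ 2) \<le> 1}"
  by (auto simp: nball_def Euclidean_space_def subtopology_subtopology Int_def)

lemma continuous_map_nball_projection: "continuous_map (nball n) euclideanreal (\<lambda>x. x k)"
  unfolding nball_eq
  by (blast intro: continuous_map_from_subtopology [OF continuous_map_product_projection])

text \<open>
  The ball is the cone over its boundary, so a null-homotopy can be run along the radii, from the
  boundary inwards. It is squeezed into the shell of radii between \<open>1/2\<close> and \<open>1\<close>, and the inner ball is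
  mapped to the constant: the direction of a vector is not continuous at the origin.
\<close>

lemma nullhomotopic_imp_extends_to_nball:
  assumes "homotopic_with (\<lambda>_. True) (nsphere j) X f (\<lambda>_. c)"
  shows "\<exists>g. continuous_map (nball (Suc j)) X g \<and> (\<forall>x \<in> topspace (nsphere j). g x = f x)"
proof -
  obtain h where h: "continuous_map (prod_topology (top_of_set {0..1::real}) (nsphere j)) X h"
    and h0: "\<And>x. h (0, x) = f x" and h1: "\<And>x. h (1, x) = c"
    using assms unfolding homotopic_with_def by auto
  have c: "c \<in> topspace X"
    using homotopic_with_imp_continuous_maps[OF assms] in_topspace_nsphere[of j]
    by (auto simp: continuous_map_def)
  define N where "N = (\<lambda>x::nat\<Rightarrow>real. sqrt (\<Sum>i<Suc j. x i ^ 2))"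
  define g where "g = (\<lambda>x. if 1/2 \<le> N x then h (2 - 2 * N x, \<lambda>i. x i / N x) else c)"
  have N: "continuous_map (nball (Suc j)) euclideanreal N"
    unfolding N_def
    by (rule continuous_map_compose[of _ euclideanreal "\<lambda>x. \<Sum>i<Suc j. x i ^ 2" euclideanreal sqrt, unfolded o_def])
      (auto simp: continuous_on_real_sqrt intro!: continuous_intros continuous_map_nball_projection)
  have "continuous_map (nball (Suc j)) X g"
    unfolding g_def
  proof (rule continuous_map_cases_le)
    let ?S = "subtopology (nball (Suc j)) {x \<in> topspace (nball (Suc j)). 1/2 \<le> N x}"
    have Nx: "(\<Sum>i\<le>j. (x i / N x)\<^sup>2) = 1" if "1/2 \<le> N x" for x
    proof -
      have *: "(N x)\<^sup>2 = (\<Sum>i<Suc j. x i ^ 2)"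
        unfolding N_def by (rule real_sqrt_pow2) (rule sum_nonneg, simp)
      have "N x \<noteq> 0"
        using that by auto
      have "(\<Sum>i\<le>j. (x i / N x)\<^sup>2) = (\<Sum>i\<le>j. (x i)\<^sup>2) / (N x)\<^sup>2"
        by (simp add: power_divide sum_divide_distrib)
      also have "\<dots> = 1"
        unfolding *[unfolded lessThan_Suc_atMost, symmetric]
        using \<open>N x \<noteq> 0\<close> by simp
      finally show ?thesis .
    qed
    have *: "continuous_map ?S (prod_topology (top_of_set {0..1::real}) (nsphere j)) (\<lambda>x. (2 - 2 * N x, \<lambda>i. x i / N x))"
    proof (rule continuous_map_pairedI)
      have "N x \<le> 1" if "x \<in> topspace (nball (Suc j))" for x
        using that by (auto simp: topspace_nball N_def)
      moreover have "continuous_map ?S euclideanreal (\<lambda>x. 2 - 2 * N x)"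
        by (intro continuous_map_diff continuous_map_real_mult_left
              continuous_map_from_subtopology[OF N]) simp_all
      ultimately show "continuous_map ?S (top_of_set {0..1}) (\<lambda>x. 2 - 2 * N x)"
        by (auto simp: continuous_map_in_subtopology)
      have "continuous_map ?S euclideanreal (\<lambda>x. x i / N x)" for i
        by (rule continuous_map_real_divide continuous_map_from_subtopology[OF N]
              continuous_map_from_subtopology[OF continuous_map_nball_projection])+ auto
      then show "continuous_map ?S (nsphere j) (\<lambda>x i. x i / N x)"
        using Nx by (auto simp: nsphere continuous_map_in_subtopology continuous_map_componentwise_UNIV topspace_nball)
    qed
    show "continuous_map ?S X (\<lambda>x. h (2 - 2 * N x, \<lambda>i. x i / N x))"
      using continuous_map_compose[OF * h] by (simp add: o_def)
    show "continuous_map (nball (Suc j)) euclideanreal N"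
      by (rule N)
    show "h (2 - 2 * N x, \<lambda>i. x i / N x) = c" if "1 / 2 = N x" for x
      unfolding that[symmetric] using h1 by simp
  qed (use c in simp_all)
  moreover have "g x = f x" if "x \<in> topspace (nsphere j)" for x
  proof -
    have "N x = 1"
      using that by (simp add: N_def topspace_nsphere lessThan_Suc_atMost)
    then show ?thesis
      by (simp add: g_def h0)
  qed
  ultimately show ?thesis by blast
qed

section \<open>Lipschitz maps from spheres are not surjective onto higher dimensions\<close>

lemma nsphere_eq_top_of_set: "nsphere j = top_of_set (topspace (nsphere j))"
  by (simp add: nsphere euclidean_product_topology)

lemma compact_topspace_nsphere: "compact (topspace (nsphere j))"
proof -
  have "compactin (powertop_real UNIV) (PiE UNIV (\<lambda>_::nat. {-1..1::real}))"
    by (simp add: compactin_PiE)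
  then have cube: "compact (PiE UNIV (\<lambda>_::nat. {-1..1::real}))"
    by (simp add: euclidean_product_topology)
  have "closed {x::nat\<Rightarrow>real. (\<Sum>i\<le>j. x i ^ 2) = 1}"
    by (intro closed_Collect_eq continuous_intros continuous_on_product_coordinates)
  moreover have "closed {x::nat\<Rightarrow>real. \<forall>i. i > j \<longrightarrow> x i = 0}"
    by (intro closed_Collect_all closed_Collect_imp closed_Collect_eq continuous_intros
        continuous_on_product_coordinates) auto
  ultimately have "compact (PiE UNIV (\<lambda>_::nat. {-1..1::real}) \<inter>
      ({x. (\<Sum>i\<le>j. x i ^ 2) = 1} \<inter> {x. \<forall>i. i > j \<longrightarrow> x i = 0}))"
    using cube by (intro compact_Int_closed closed_Int)
  moreover have "topspace (nsphere j) = PiE UNIV (\<lambda>_::nat. {-1..1::real}) \<inter>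
      ({x. (\<Sum>i\<le>j. x i ^ 2) = 1} \<inter> {x. \<forall>i. i > j \<longrightarrow> x i = 0})"
  proof -
    have "x i \<in> {-1..1}" if "(\<Sum>i\<le>j. x i ^ 2) = 1" "\<forall>i>j. x i = 0" for x :: "nat \<Rightarrow> real" and i
    proof (cases "i \<le> j")
      case True
      then have "x i ^ 2 \<le> 1"
        using member_le_sum[of i "{..j}" "\<lambda>i. x i ^ 2"] that(1) by simp
      then show ?thesis
        by (simp add: abs_square_le_1 abs_le_iff)
    qed (use that in simp)
    then show ?thesis
      by (auto simp: topspace_nsphere)
  qed
  ultimately show ?thesis by simp
qed

text \<open>
  The distance to a closed set of sequences refers to the metric of the product topology, whereas grids
  on a sphere are measured coordinatewise. The factor \<open>2\<close> is the sum of the geometric weights in that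
  metric.
\<close>

lemma dist_fun_le_sum:
  fixes x y :: "nat \<Rightarrow> real"
  assumes "\<And>i. i > j \<Longrightarrow> x i = y i"
  shows "dist x y \<le> 2 * (\<Sum>i\<le>j. \<bar>x i - y i\<bar>)"
proof -
  define D where "D = (\<Sum>i\<le>j. \<bar>x i - y i\<bar>)"
  have le: "\<bar>x i - y i\<bar> \<le> D" for i
  proof (cases "i \<le> j")
    case True
    then show ?thesis
      unfolding D_def using member_le_sum[of i "{..j}" "\<lambda>i. \<bar>x i - y i\<bar>"] by simp
  next
    case False
    then show ?thesis
      using assms[of i] by (simp add: D_def sum_nonneg)
  qed
  have D: "0 \<le> D"
    by (simp add: D_def sum_nonneg)
  have sum: "(\<lambda>n. (1/2)^n * D) sums (2 * D)"
    using sums_mult2[OF geometric_sums[of "1/2::real"], of D] by simp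
  have bound: "(1/2)^n * min (dist (x (from_nat n)) (y (from_nat n))) 1 \<le> (1/2)^n * D" for n
    using le[of "from_nat n"] by (intro mult_left_mono) (auto simp: dist_real_def)
  have "summable (\<lambda>n. (1/2)^n * min (dist (x (from_nat n)) (y (from_nat n))) 1)"
    by (rule summable_comparison_test'[OF sums_summable[OF sum], of 0]) (use bound in \<open>simp add: abs_mult\<close>)
  then have "dist x y \<le> suminf (\<lambda>n. (1/2)^n * D)"
    unfolding dist_fun_def using bound sums_summable[OF sum] by (intro suminf_le)
  then show ?thesis
    using sums_unique[OF sum] by (simp add: D_def)
qed

text \<open>
  The sphere of dimension \<open>j\<close> is covered by \<open>O(N ^ j)\<close> sets of diameter \<open>O(1 / N)\<close>, although it lives in
  \<open>j + 1\<close> coordinates: one coordinate is determined up to its sign by the others. This dependence is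
  Lipschitz if the square of the dependent coordinate is at least the average \<open>1 / (j + 1)\<close>, and each
  point has such a coordinate. A cell records its index, its sign, and the other coordinates rounded
  to multiples of \<open>1 / N\<close>.
\<close>

lemma sphere_grid:
  fixes N :: nat
  assumes N: "N > 0"
  shows "\<exists>cell :: (nat \<Rightarrow> real) \<Rightarrow> nat \<times> bool \<times> (nat \<Rightarrow> int).
     finite (cell ` topspace (nsphere j)) \<and>
     card (cell ` topspace (nsphere j)) \<le> Suc j * (2 * (2 * N + 1) ^ j) \<and>
     (\<forall>x\<in>topspace (nsphere j). \<forall>y\<in>topspace (nsphere j). cell x = cell y \<longrightarrow>
        (\<Sum>i\<le>j. \<bar>x i - y i\<bar>) \<le> real ((j + 2) * j) / real N)"
proof -
  let ?S = "topspace (nsphere j)"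
  have "\<exists>k\<le>j. 1 / real (Suc j) \<le> x k ^ 2" if "x \<in> ?S" for x
  proof (rule ccontr)
    assume "\<not> ?thesis"
    then have "x i ^ 2 < 1 / real (Suc j)" if "i \<le> j" for i
      using that by (metis not_le)
    then have "(\<Sum>i\<le>j. x i ^ 2) < (\<Sum>i\<le>j. 1 / real (Suc j))"
      by (intro sum_strict_mono) auto
    then show False
      using that by (simp add: topspace_nsphere)
  qed
  then obtain big where big: "big x \<le> j" "1 / real (Suc j) \<le> x (big x) ^ 2" if "x \<in> ?S" for x
    by metis
  have le1: "\<bar>x i\<bar> \<le> 1" if "x \<in> ?S" "i \<le> j" for x i
    using member_le_sum[of i "{..j}" "\<lambda>i. x i ^ 2"] that by (simp add: topspace_nsphere abs_square_le_1)
  define cell where "cell = (\<lambda>x::nat\<Rightarrow>real. (big x, 0 \<le> x (big x), \<lambda>i\<in>{..j} - {big x}. \<lfloor>real N * x i\<rfloor>))"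
  let ?C = "Sigma {..j} (\<lambda>k. (UNIV::bool set) \<times> (({..j} - {k}) \<rightarrow>\<^sub>E {- int N..int N}))"
  have fl: "\<lfloor>real N * x i\<rfloor> \<in> {- int N..int N}" if "x \<in> ?S" "i \<le> j" for x i
  proof -
    have "\<bar>real N * x i\<bar> \<le> real N"
      using le1[OF that] N by (simp add: abs_mult mult_left_le)
    then show ?thesis
      by (auto simp: le_floor_iff floor_le_iff abs_le_iff)
  qed
  have sub: "cell ` ?S \<subseteq> ?C"
  proof (rule image_subsetI)
    fix x assume x: "x \<in> ?S"
    have "(\<lambda>i\<in>{..j} - {big x}. \<lfloor>real N * x i\<rfloor>) \<in> ({..j} - {big x}) \<rightarrow>\<^sub>E {- int N..int N}"
      using fl[OF x] by (intro restrict_PiE_iff[THEN iffD2] ballI) auto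
    then show "cell x \<in> ?C"
      using big(1)[OF x] by (simp add: cell_def)
  qed
  have finC: "finite ?C"
    by (intro finite_SigmaI finite_cartesian_product finite_PiE) auto
  have "card ?C = (\<Sum>k\<le>j. 2 * (2 * N + 1) ^ j)"
  proof -
    have card_int: "card {- int N..int N} = 2 * N + 1"
      unfolding card_atLeastAtMost_int by linarith
    have "card (({..j} - {k}) \<rightarrow>\<^sub>E {- int N..int N}) = (2 * N + 1) ^ j" if "k \<le> j" for k
      using that card_int by (simp add: card_PiE)
    then show ?thesis
      by (subst card_SigmaI) (auto intro!: finite_cartesian_product finite_PiE simp: card_cartesian_product)
  qed
  then have card: "card (cell ` ?S) \<le> Suc j * (2 * (2 * N + 1) ^ j)"
    using card_mono[OF finC sub] by simp
  have "(\<Sum>i\<le>j. \<bar>x i - y i\<bar>) \<le> real ((j + 2) * j) / real N"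
    if x: "x \<in> ?S" and y: "y \<in> ?S" and eq: "cell x = cell y" for x y
  proof -
    define k where "k = big x"
    have k: "k \<le> j" "big y = k" "0 \<le> x k \<longleftrightarrow> 0 \<le> y k"
      using eq big(1)[OF x] by (auto simp: cell_def k_def)
    define I where "I = {..j} - {k}"
    have close: "\<bar>x i - y i\<bar> \<le> 1 / real N" if i: "i \<in> I" for i
    proof -
      have "(\<lambda>i\<in>I. \<lfloor>real N * x i\<rfloor>) = (\<lambda>i\<in>I. \<lfloor>real N * y i\<rfloor>)"
        using eq k(2) by (simp add: cell_def k_def I_def)
      then have "\<lfloor>real N * x i\<rfloor> = \<lfloor>real N * y i\<rfloor>"
        using i by (metis restrict_apply')
      then have "\<bar>real N * x i - real N * y i\<bar> < 1"
        by linarith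
      then have "real N * \<bar>x i - y i\<bar> < 1"
        by (simp add: abs_mult flip: right_diff_distrib)
      then show ?thesis
        using N by (simp add: field_simps)
    qed
    have cardI: "card I = j"
      using k(1) by (simp add: I_def)
    define E where "E = (\<Sum>i\<in>I. \<bar>x i - y i\<bar>)"
    have E: "E \<le> real j / real N"
      unfolding E_def using sum_bounded_above[of I "\<lambda>i. \<bar>x i - y i\<bar>", OF close] cardI by simp
    have split: "(\<Sum>i\<le>j. u i) = u k + (\<Sum>i\<in>I. u i)" for u :: "nat \<Rightarrow> real"
      unfolding I_def using k(1) by (subst sum.remove[of _ k]) auto
    \<comment> \<open>The dependent coordinate is compared through the difference of squares.\<close>
    have "x k ^ 2 - y k ^ 2 = (\<Sum>i\<in>I. y i ^ 2 - x i ^ 2)"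
      using x y split[of "\<lambda>i. x i ^ 2"] split[of "\<lambda>i. y i ^ 2"]
      by (simp add: topspace_nsphere sum_subtractf)
    also have "\<bar>\<dots>\<bar> \<le> (\<Sum>i\<in>I. \<bar>y i ^ 2 - x i ^ 2\<bar>)"
      by (rule sum_abs)
    also have "\<dots> \<le> (\<Sum>i\<in>I. 2 * \<bar>x i - y i\<bar>)"
    proof (rule sum_mono)
      fix i assume "i \<in> I"
      then have "\<bar>x i + y i\<bar> \<le> 2"
        using le1[OF x, of i] le1[OF y, of i] by (auto simp: I_def)
      then have "\<bar>x i - y i\<bar> * \<bar>x i + y i\<bar> \<le> \<bar>x i - y i\<bar> * 2"
        by (intro mult_left_mono) auto
      moreover have "\<bar>y i ^ 2 - x i ^ 2\<bar> = \<bar>x i - y i\<bar> * \<bar>x i + y i\<bar>"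
        by (simp add: power2_eq_square square_diff_square_factored abs_mult abs_minus_commute mult.commute add.commute)
      ultimately show "\<bar>y i ^ 2 - x i ^ 2\<bar> \<le> 2 * \<bar>x i - y i\<bar>" by simp
    qed
    also have "\<dots> = 2 * E"
      by (simp add: E_def sum_distrib_left)
    finally have sq: "\<bar>x k ^ 2 - y k ^ 2\<bar> \<le> 2 * E" .
    have lower: "1 / real (Suc j) \<le> \<bar>u k\<bar>" if "u \<in> ?S" "big u = k" for u
    proof -
      have "u k ^ 2 \<le> \<bar>u k\<bar>"
        using mult_left_mono[OF le1[OF that(1) k(1)], of "\<bar>u k\<bar>"] by (simp add: power2_eq_square abs_mult_self_eq)
      then show ?thesis
        using big(2)[OF that(1)] that(2) by simp
    qed
    have "\<bar>x k - y k\<bar> * (2 / real (Suc j)) \<le> \<bar>x k - y k\<bar> * (\<bar>x k\<bar> + \<bar>y k\<bar>)"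
      using lower[OF x] lower[OF y k(2)] by (intro mult_left_mono) (auto simp: k_def)
    also have "\<bar>x k\<bar> + \<bar>y k\<bar> = \<bar>x k + y k\<bar>"
      using k(3) by auto
    also have "\<bar>x k - y k\<bar> * \<bar>x k + y k\<bar> = \<bar>x k ^ 2 - y k ^ 2\<bar>"
      by (simp add: power2_eq_square square_diff_square_factored abs_mult mult.commute)
    finally have "\<bar>x k - y k\<bar> * (2 / real (Suc j)) \<le> 2 * E"
      using sq by linarith
    then have "\<bar>x k - y k\<bar> \<le> real (Suc j) * E"
      by (simp add: field_simps)
    then have "(\<Sum>i\<le>j. \<bar>x i - y i\<bar>) \<le> real (j + 2) * E"
      using split[of "\<lambda>i. \<bar>x i - y i\<bar>"] by (simp add: E_def algebra_simps)
    also have "\<dots> \<le> real (j + 2) * (real j / real N)"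
      using E by (intro mult_left_mono) auto
    finally show ?thesis
      by (simp only: of_nat_mult times_divide_eq_right)
  qed
  then show ?thesis
    using card finite_subset[OF sub finC] by (intro exI[of _ cell]) blast
qed

text \<open>
  The facet \<open>z (p + 2) = 0\<close> of the standard simplex has dimension \<open>p\<close> and contains \<open>N ^ p\<close> points at
  mutual distance at least \<open>1 / ((p + 2) * N)\<close>. The sphere has \<open>O(N ^ j)\<close> grid cells whose images are
  smaller than that. As \<open>j < p\<close>, for large \<open>N\<close> there are fewer cells than points, so the map cannot
  hit all these points.
\<close>

lemma lipschitz_sphere_map_misses_point:
  fixes g :: "(nat \<Rightarrow> real) \<Rightarrow> nat \<Rightarrow> real"
  assumes lip: "\<And>x y v. x \<in> topspace (nsphere j) \<Longrightarrow> y \<in> topspace (nsphere j) \<Longrightarrow> v \<in> {1..p + 2} \<Longrightarrow>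
      \<bar>g x v - g y v\<bar> \<le> C * (\<Sum>i\<le>j. \<bar>x i - y i\<bar>)"
    and C: "0 \<le> C" and jp: "j < p"
  shows "\<exists>z. (\<forall>v\<in>{1..p + 2}. 0 \<le> z v) \<and> (\<Sum>v=1..p + 2. z v) = 1 \<and> z (p + 2) = 0 \<and>
      (\<forall>x\<in>topspace (nsphere j). \<exists>v\<in>{1..p + 2}. g x v \<noteq> z v)"
proof (rule ccontr)
  let ?S = "topspace (nsphere j)"
  assume "\<not> ?thesis"
  then have onto: "\<exists>x\<in>?S. \<forall>v\<in>{1..p + 2}. g x v = z v"
    if "\<forall>v\<in>{1..p + 2}. 0 \<le> z v" "(\<Sum>v=1..p + 2. z v) = 1" "z (p + 2) = 0" for z
    using that by blast
  \<comment> \<open>The grid is finer than the spacing of the points by the factor \<open>K\<close>, which beats the Lipschitz constant.\<close>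
  obtain K :: nat where K: "C * real ((j + 2) * j) * real (p + 2) < real K"
    using reals_Archimedean2 by blast
  have K0: "K > 0"
    using K C by (metis gr0I mult_nonneg_nonneg not_less of_nat_0 of_nat_0_le_iff)
  \<comment> \<open>There are at most \<open>B * N ^ j\<close> cells, so \<open>N = B + 1\<close> makes them fewer than \<open>N ^ p\<close>.\<close>
  define B where "B = Suc j * (2 * (2 * K + 1) ^ j)"
  define N where "N = Suc B"
  obtain cell :: "(nat \<Rightarrow> real) \<Rightarrow> nat \<times> bool \<times> (nat \<Rightarrow> int)" where
    fin: "finite (cell ` ?S)" and card: "card (cell ` ?S) \<le> Suc j * (2 * (2 * (K * N) + 1) ^ j)"
    and cell: "\<And>x y. x \<in> ?S \<Longrightarrow> y \<in> ?S \<Longrightarrow> cell x = cell y \<Longrightarrow>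
        (\<Sum>i\<le>j. \<bar>x i - y i\<bar>) \<le> real ((j + 2) * j) / real (K * N)"
    using sphere_grid[of "K * N" j] K0 by (auto simp: N_def)
  define P where "P = ({1..p} \<rightarrow>\<^sub>E {..<N})"
  define M where "M = real (p + 2) * real N"
  have M: "M > 0"
    by (simp add: M_def N_def)
  define E Q where "E = real ((j + 2) * j)" and "Q = real (K * N)"
  have Q: "Q > 0"
    unfolding Q_def of_nat_0_less_iff using K0 by (simp add: N_def)
  \<comment> \<open>Coordinate \<open>p + 1\<close> is used to fill up the sum to 1.\<close>
  define z where "z = (\<lambda>a::nat\<Rightarrow>nat. \<lambda>v. if v \<le> p then real (a v) / M
      else if v = p + 1 then 1 - (\<Sum>u=1..p. real (a u) / M) else 0)"
  have "\<exists>x\<in>?S. \<forall>v\<in>{1..p + 2}. g x v = z a v" if a: "a \<in> P" for a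
  proof (rule onto)
    have "(\<Sum>u=1..p. real (a u) / M) \<le> (\<Sum>u=1..p. real N / M)"
      using a M by (intro sum_mono divide_right_mono) (auto simp: P_def PiE_iff less_imp_le)
    also have "\<dots> \<le> 1"
      using M by (simp add: M_def N_def field_simps)
    finally show "\<forall>v\<in>{1..p + 2}. 0 \<le> z a v"
      using M by (auto simp: z_def)
    show "(\<Sum>v=1..p + 2. z a v) = 1"
      by (simp add: z_def)
    show "z a (p + 2) = 0"
      by (simp add: z_def)
  qed
  then have "\<forall>a\<in>P. \<exists>y. y \<in> ?S \<and> (\<forall>v\<in>{1..p + 2}. g y v = z a v)"
    by blast
  then obtain pre where "\<forall>a\<in>P. pre a \<in> ?S \<and> (\<forall>v\<in>{1..p + 2}. g (pre a) v = z a v)"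
    unfolding bchoice_iff by blast
  then have pre: "pre a \<in> ?S" "\<And>v. v \<in> {1..p + 2} \<Longrightarrow> g (pre a) v = z a v" if "a \<in> P" for a
    using that by blast+
  have "2 * (K * N) + 1 \<le> (2 * K + 1) * N"
    by (simp add: N_def algebra_simps)
  then have "card (cell ` ?S) \<le> Suc j * (2 * ((2 * K + 1) * N) ^ j)"
    using card by (meson le_trans mult_le_mono2 power_mono zero_le)
  also have "\<dots> = B * N ^ j"
    by (simp only: B_def power_mult_distrib mult.assoc)
  also have "\<dots> < N * N ^ j"
    by (simp add: N_def)
  also have "\<dots> \<le> N ^ p"
    using jp power_increasing[of "Suc j" p N] by (simp add: N_def)
  also have "\<dots> = card P"
    by (simp add: P_def card_PiE)
  finally have "card (cell ` ?S) < card P" .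
  moreover have "card ((\<lambda>a. cell (pre a)) ` P) \<le> card (cell ` ?S)"
    using pre(1) by (intro card_mono fin) auto
  ultimately have "\<not> inj_on (\<lambda>a. cell (pre a)) P"
    by (metis card_image not_less)
  then obtain a b where ab: "a \<in> P" "b \<in> P" "a \<noteq> b" "cell (pre a) = cell (pre b)"
    by (auto simp: inj_on_def)
  obtain v where v: "v \<in> {1..p}" "a v \<noteq> b v"
    using ab(1-3) unfolding P_def by (metis PiE_ext)
  have "1 \<le> \<bar>real (a v) - real (b v)\<bar>"
    using v(2) by linarith
  then have "1 / M \<le> \<bar>real (a v) - real (b v)\<bar> / M"
    using M by (intro divide_right_mono) auto
  also have "\<dots> = \<bar>z a v - z b v\<bar>"
    using v M by (simp add: z_def abs_divide flip: diff_divide_distrib)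
  also have "\<dots> = \<bar>g (pre a) v - g (pre b) v\<bar>"
    using pre(2)[OF ab(1)] pre(2)[OF ab(2)] v by simp
  also have "\<dots> \<le> C * (\<Sum>i\<le>j. \<bar>pre a i - pre b i\<bar>)"
    using pre(1) ab v by (intro lip) auto
  also have "\<dots> \<le> C * (real ((j + 2) * j) / real (K * N))"
    using cell[OF pre(1)[OF ab(1)] pre(1)[OF ab(2)] ab(4)] C by (intro mult_left_mono)
  finally have "1 / M \<le> C * (E / Q)"
    unfolding E_def Q_def .
  then have "Q \<le> C * E * M"
    using M Q by (simp add: field_simps)
  then have "real K * real N \<le> C * E * real (p + 2) * real N"
    by (simp add: M_def Q_def mult.assoc)
  then have "real K \<le> C * E * real (p + 2)"
    by (rule mult_right_le_imp_le) (simp add: N_def)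
  then show False
    using K by (simp add: E_def)
qed

section \<open>The boundary of a simplex as a sphere\<close>

text \<open>
  A set of vertices of a complete graph has a common neighbour iff it omits a vertex: the neighborhood
  complex is the boundary complex of the simplex.
\<close>

abbreviation boundary_complex :: "nat \<Rightarrow> nat set set" where
  "boundary_complex m \<equiv> neighborhood_complex (complete_graph m)"

lemma in_boundary_complex_iff: "A \<in> boundary_complex m \<longleftrightarrow> A \<subset> {1..m}"
proof -
  have "A \<in> boundary_complex m \<longleftrightarrow> A \<subseteq> {1..m} \<and> (\<exists>x\<in>{1..m}. \<forall>a\<in>A. a \<in> {1..m} \<and> x \<noteq> a)"
    by (auto simp: neighborhood_complex_def complete_graph_def)
  then show ?thesis
    by blast
qed

lemma Union_boundary_complex:
  assumes "2 \<le> m" shows "\<Union>(boundary_complex m) = {1..m}"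
proof -
  have "{v} \<in> boundary_complex m" if "v \<in> {1..m}" for v
  proof -
    have "(if v = 1 then 2 else 1) \<in> {1..m} - {v}"
      using assms by auto
    then show ?thesis
      using that unfolding in_boundary_complex_iff by blast
  qed
  moreover have "A \<subseteq> {1..m}" if "A \<in> boundary_complex m" for A
    using that unfolding in_boundary_complex_iff by (rule psubset_imp_subset)
  ultimately show ?thesis
    by (intro equalityI Union_least) blast+
qed

lemma topspace_boundary:
  assumes "2 \<le> m"
  shows "t \<in> topspace (geometric_realization (boundary_complex m)) \<longleftrightarrow>
    t \<in> extensional {1..m} \<and> (\<forall>v\<in>{1..m}. 0 \<le> t v) \<and> (\<Sum>v=1..m. t v) = 1 \<and> (\<exists>v\<in>{1..m}. t v = 0)"
  unfolding topspace_geometric_realization Union_boundary_complex[OF assms] in_boundary_complex_iff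
  by blast

lemma continuous_map_Min:
  fixes f :: "'a \<Rightarrow> 'b \<Rightarrow> real"
  assumes "finite I" "I \<noteq> {}" "\<And>v. v \<in> I \<Longrightarrow> continuous_map X euclideanreal (\<lambda>x. f x v)"
  shows "continuous_map X euclideanreal (\<lambda>x. Min (f x ` I))"
  using assms
proof (induction rule: finite_ne_induct)
  case (insert v I)
  then have "continuous_map X euclideanreal (\<lambda>x. min (f x v) (Min (f x ` I)))"
    by (intro continuous_map_real_min) auto
  with insert show ?case
    by simp
qed simp

text \<open>
  This is the radial projection, from the barycentre, onto the boundary of the simplex, extended to all
  tuples that are not constant by first shifting along the diagonal. Homotopies into the boundary can
  thus be given by arbitrary formulas that avoid constant tuples.
\<close>

definition radial :: "nat \<Rightarrow> (nat \<Rightarrow> real) \<Rightarrow> nat \<Rightarrow> real" where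
  "radial m y = (\<lambda>v\<in>{1..m}. (y v - Min (y ` {1..m})) / (\<Sum>w=1..m. y w - Min (y ` {1..m})))"

lemma radial_denominator_pos:
  fixes y :: "nat \<Rightarrow> real"
  assumes "\<exists>v\<in>{1..m}. \<exists>w\<in>{1..m}. y v \<noteq> y w"
  shows "0 < (\<Sum>w=1..m. y w - Min (y ` {1..m}))"
proof -
  have ge: "Min (y ` {1..m}) \<le> y v" if "v \<in> {1..m}" for v
    using that by (intro Min_le) auto
  have "\<exists>v\<in>{1..m}. y v \<noteq> Min (y ` {1..m})"
    using assms by metis
  then obtain v where v: "v \<in> {1..m}" "Min (y ` {1..m}) < y v"
    using ge by (metis order_less_le)
  show ?thesis
    by (rule sum_pos2[where i = v]) (use v ge in \<open>simp_all del: sum_subtractf\<close>)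
qed

lemma radial_in_boundary:
  assumes m: "2 \<le> m" and y: "\<exists>v\<in>{1..m}. \<exists>w\<in>{1..m}. y v \<noteq> y w"
  shows "radial m y \<in> topspace (geometric_realization (boundary_complex m))"
  unfolding topspace_boundary[OF m]
proof (intro conjI)
  let ?d = "\<Sum>w=1..m. y w - Min (y ` {1..m})"
  have d: "0 < ?d"
    by (rule radial_denominator_pos[OF y])
  show "radial m y \<in> extensional {1..m}"
    by (simp add: radial_def)
  show "\<forall>v\<in>{1..m}. 0 \<le> radial m y v"
    using d by (simp add: radial_def)
  have "(\<Sum>v=1..m. radial m y v) = (\<Sum>v=1..m. (y v - Min (y ` {1..m})) / ?d)"
    by (rule sum.cong) (simp_all add: radial_def)
  also have "\<dots> = 1"
    using d by (simp flip: sum_divide_distrib)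
  finally show "(\<Sum>v=1..m. radial m y v) = 1" .
  have "Min (y ` {1..m}) \<in> y ` {1..m}"
    using m by (intro Min_in) auto
  then obtain v where "v \<in> {1..m}" "y v = Min (y ` {1..m})"
    by auto
  then show "\<exists>v\<in>{1..m}. radial m y v = 0"
    by (intro bexI[of _ v]) (simp_all add: radial_def)
qed

lemma continuous_map_radial:
  assumes m: "2 \<le> m"
    and cont: "\<And>v. v \<in> {1..m} \<Longrightarrow> continuous_map X euclideanreal (\<lambda>x. f x v)"
    and nonconst: "\<And>x. x \<in> topspace X \<Longrightarrow> \<exists>v\<in>{1..m}. \<exists>w\<in>{1..m}. f x v \<noteq> f x w"
  shows "continuous_map X (geometric_realization (boundary_complex m)) (\<lambda>x. radial m (f x))"
  unfolding continuous_map_into_geometric_realization Union_boundary_complex[OF m]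
proof (intro conjI ballI)
  show "(\<lambda>x. radial m (f x)) \<in> topspace X \<rightarrow> topspace (geometric_realization (boundary_complex m))"
    using radial_in_boundary[OF m nonconst] by simp
  have Min: "continuous_map X euclideanreal (\<lambda>x. Min (f x ` {1..m}))"
    using m by (intro continuous_map_Min cont) auto
  have nz: "(\<Sum>w=1..m. f x w - Min (f x ` {1..m})) \<noteq> 0" if "x \<in> topspace X" for x
    using radial_denominator_pos[OF nonconst[OF that]] by (rule less_imp_neq[symmetric])
  fix v assume v: "v \<in> {1..m}"
  have "continuous_map X euclideanreal
      (\<lambda>x. (f x v - Min (f x ` {1..m})) / (\<Sum>w=1..m. f x w - Min (f x ` {1..m})))"
    by (intro continuous_map_real_divide continuous_map_sum continuous_map_diff cont Min)
      (use v nz in \<open>simp_all del: sum_subtractf\<close>)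
  then show "continuous_map X euclideanreal (\<lambda>x. radial m (f x) v)"
    using v by (simp add: radial_def)
qed

lemma radial_boundary:
  assumes m: "2 \<le> m" and t: "t \<in> topspace (geometric_realization (boundary_complex m))"
  shows "radial m t = t"
proof -
  have t': "t \<in> extensional {1..m}" "\<And>v. v \<in> {1..m} \<Longrightarrow> 0 \<le> t v" "(\<Sum>v=1..m. t v) = 1" "\<exists>v\<in>{1..m}. t v = 0"
    using t unfolding topspace_boundary[OF m] by blast+
  have Min0: "Min (t ` {1..m}) = 0"
    using t'(2,4) by (intro Min_eqI) (auto simp: image_iff)
  show ?thesis
  proof
    fix v
    show "radial m t v = t v"
    proof (cases "v \<in> {1..m}")
      case True
      then show ?thesis
        unfolding radial_def Min0 by (simp only: restrict_apply' diff_zero t'(3) div_by_1)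
    next
      case False
      then show ?thesis
        using extensional_arb[OF t'(1) False] False
        unfolding radial_def restrict_apply by (simp only: if_False)
    qed
  qed
qed

lemma boundary_not_constant:
  assumes m: "2 \<le> m" and t: "t \<in> topspace (geometric_realization (boundary_complex m))"
  shows "\<exists>v\<in>{1..m}. \<exists>w\<in>{1..m}. t v \<noteq> t w"
proof (rule ccontr)
  assume "\<not> ?thesis"
  then have "\<forall>v\<in>{1..m}. t v = 0"
    using t unfolding topspace_boundary[OF m] by metis
  then show False
    using t unfolding topspace_boundary[OF m] by simp
qed

text \<open>
  Each coordinate of \<open>f\<close> is replaced by the distance to its zero set, and the result is normalized.
  Distance functions are Lipschitz, and vanish exactly where the coordinate of \<open>f\<close> does. So the supports
  do not change, and a straight-line homotopy is available. Normalization keeps the Lipschitz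
  property because the sum of the distances has a positive minimum on the compact sphere.
\<close>

lemma homotopic_lipschitz_map:
  assumes m: "2 \<le> m" and f: "continuous_map (nsphere j) (geometric_realization (boundary_complex m)) f"
  shows "\<exists>g C. homotopic_with (\<lambda>_. True) (nsphere j) (geometric_realization (boundary_complex m)) f g \<and> 0 \<le> C \<and>
    (\<forall>x\<in>topspace (nsphere j). \<forall>y\<in>topspace (nsphere j). \<forall>v\<in>{1..m}.
      \<bar>g x v - g y v\<bar> \<le> C * (\<Sum>i\<le>j. \<bar>x i - y i\<bar>))"
proof -
  let ?S = "topspace (nsphere j)" and ?B = "geometric_realization (boundary_complex m)"
  have fS: "(\<forall>v\<in>{1..m}. 0 \<le> f x v) \<and> (\<Sum>v=1..m. f x v) = 1 \<and> (\<exists>v\<in>{1..m}. f x v = 0)" if "x \<in> ?S" for x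
    using f that topspace_boundary[OF m, of "f x"] by (auto simp: continuous_map_def)
  \<comment> \<open>The distance to an empty set is 0 by convention; the origin, which is not on the sphere, prevents that case.\<close>
  define Z where "Z = (\<lambda>v. insert (\<lambda>_. 0) {y\<in>?S. f y v = 0})"
  define h where "h = (\<lambda>x v. infdist x (Z v))"
  have closed: "closed (Z v)" if v: "v \<in> {1..m}" for v
  proof -
    have "continuous_map (nsphere j) euclideanreal (\<lambda>x. f x v)"
      using f v unfolding continuous_map_into_geometric_realization Union_boundary_complex[OF m] by blast
    then have "continuous_on ?S (\<lambda>x. f x v)"
      by (subst (asm) nsphere_eq_top_of_set) simp
    moreover have "closed ?S"
      by (rule compact_imp_closed[OF compact_topspace_nsphere])
    ultimately have "closed {y\<in>?S. f y v = 0}"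
      using continuous_closed_preimage_constant by blast
    then show ?thesis
      unfolding Z_def by (rule closed_insert)
  qed
  have h_zero: "h x v = 0 \<longleftrightarrow> f x v = 0" if "x \<in> ?S" "v \<in> {1..m}" for x v
  proof -
    have "x \<noteq> (\<lambda>_. 0)"
      using that(1) by (auto simp: topspace_nsphere)
    moreover have "h x v = 0 \<longleftrightarrow> x \<in> Z v"
      unfolding h_def using in_closed_iff_infdist_zero[OF closed[OF that(2)]] by (simp add: Z_def)
    ultimately show ?thesis
      using that(1) by (simp add: Z_def)
  qed
  have h_nonneg: "0 \<le> h x v" for x v
    by (simp add: h_def infdist_nonneg)
  define s where "s = (\<lambda>x. \<Sum>v=1..m. h x v)"
  have s_pos: "0 < s x" if x: "x \<in> ?S" for x
  proof -
    obtain v where v: "v \<in> {1..m}" "f x v \<noteq> 0"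
      using fS[OF x] by (metis sum.neutral zero_neq_one)
    have "0 < h x v"
      using h_zero[OF x v(1)] v(2) h_nonneg[of x v] by simp
    show ?thesis
      unfolding s_def by (rule sum_pos2[where i = v]) (use v h_nonneg \<open>0 < h x v\<close> in simp_all)
  qed
  have h_cont: "continuous_on A (\<lambda>x. h x v)" for A v
    unfolding h_def by (intro continuous_intros)
  have "continuous_on ?S s"
    unfolding s_def by (intro continuous_intros h_cont)
  moreover have "?S \<noteq> {}"
    using in_topspace_nsphere by blast
  ultimately obtain x0 where x0: "x0 \<in> ?S" "\<And>x. x \<in> ?S \<Longrightarrow> s x0 \<le> s x"
    using continuous_attains_inf[OF compact_topspace_nsphere] by metis
  define g where "g = (\<lambda>x. \<lambda>v\<in>{1..m}. h x v / s x)"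
  have g_top: "g x \<in> topspace ?B" if x: "x \<in> ?S" for x
    unfolding topspace_boundary[OF m]
  proof (intro conjI)
    show "g x \<in> extensional {1..m}" by (simp add: g_def)
    show "\<forall>v\<in>{1..m}. 0 \<le> g x v"
      using s_pos[OF x] h_nonneg by (simp add: g_def)
    have "(\<Sum>v=1..m. g x v) = (\<Sum>v=1..m. h x v / s x)"
      by (rule sum.cong) (simp_all add: g_def)
    also have "\<dots> = 1"
      using s_pos[OF x] by (simp add: s_def flip: sum_divide_distrib)
    finally show "(\<Sum>v=1..m. g x v) = 1" .
    obtain v where v: "v \<in> {1..m}" "f x v = 0"
      using fS[OF x] by blast
    then show "\<exists>v\<in>{1..m}. g x v = 0"
      using h_zero[OF x v(1)] by (intro bexI[of _ v]) (simp_all add: g_def)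
  qed
  have g_zero: "g x v = 0 \<longleftrightarrow> f x v = 0" if "x \<in> ?S" "v \<in> {1..m}" for x v
    using h_zero[OF that] s_pos[OF that(1)] that by (simp add: g_def)
  have g_cont: "continuous_map (nsphere j) ?B g"
    unfolding continuous_map_into_geometric_realization Union_boundary_complex[OF m]
  proof (intro conjI ballI)
    show "g \<in> ?S \<rightarrow> topspace ?B"
      using g_top by simp
    fix v assume v: "v \<in> {1..m}"
    have "s x \<noteq> 0" if "x \<in> ?S" for x
      using s_pos[OF that] by simp
    then have "continuous_on ?S (\<lambda>x. h x v / s x)"
      using \<open>continuous_on ?S s\<close> h_cont by (intro continuous_on_divide) auto
    then show "continuous_map (nsphere j) euclideanreal (\<lambda>x. g x v)"
      using v by (subst nsphere_eq_top_of_set) (simp add: g_def)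
  qed
  have "homotopic_with (\<lambda>_. True) (nsphere j) ?B f g"
  proof (rule homotopic_with_straight_line_realization[OF _ f g_cont])
    show "B \<in> boundary_complex m" if "A \<in> boundary_complex m" "B \<subseteq> A" for A B
      using that unfolding in_boundary_complex_iff by blast
    show "{v \<in> \<Union> (boundary_complex m). f x v \<noteq> 0 \<or> g x v \<noteq> 0} \<in> boundary_complex m" if x: "x \<in> ?S" for x
      unfolding Union_boundary_complex[OF m] in_boundary_complex_iff
      using g_zero[OF x] fS[OF x] by blast
  qed
  moreover
  have "\<bar>g x v - g y v\<bar> \<le> (2 / s x0 + 2 * real m / s x0) * (\<Sum>i\<le>j. \<bar>x i - y i\<bar>)"
    if x: "x \<in> ?S" and y: "y \<in> ?S" and v: "v \<in> {1..m}" for x y v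
  proof -
    define D where "D = (\<Sum>i\<le>j. \<bar>x i - y i\<bar>)"
    have D0: "0 \<le> D"
      by (simp add: D_def sum_nonneg)
    have dist: "dist x y \<le> 2 * D"
      unfolding D_def by (rule dist_fun_le_sum) (use x y in \<open>simp add: topspace_nsphere\<close>)
    have hD: "\<bar>h x v - h y v\<bar> \<le> 2 * D" for v
      using infdist_triangle[of x "Z v" y] infdist_triangle[of y "Z v" x] dist
      by (auto simp: h_def dist_commute abs_le_iff)
    have "\<bar>s x - s y\<bar> = \<bar>\<Sum>v=1..m. h x v - h y v\<bar>"
      by (simp add: s_def sum_subtractf)
    also have "\<dots> \<le> (\<Sum>v=1..m. 2 * D)"
      by (rule order_trans[OF sum_abs sum_mono]) (rule hD)
    finally have sD: "\<bar>s y - s x\<bar> \<le> 2 * real m * D"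
      by (simp add: abs_minus_commute)
    have pos: "0 < s x" "0 < s y" "0 < s x0" "s x0 \<le> s x"
      using s_pos x y x0 by auto
    have "h y v \<le> s y"
      unfolding s_def using v h_nonneg by (intro member_le_sum) auto
    then have gy: "0 \<le> h y v / s y" "h y v / s y \<le> 1"
      using pos h_nonneg by auto
    define q where "q = h y v / s y"
    have q: "0 \<le> q" "q \<le> 1" "h y v = q * s y"
      using gy pos by (simp_all add: q_def)
    have "h x v / s x - q = (h x v - h y v) / s x + q * ((s y - s x) / s x)"
      using pos by (simp add: q(3) field_simps)
    also have "\<bar>\<dots>\<bar> \<le> \<bar>h x v - h y v\<bar> / s x + q * (\<bar>s y - s x\<bar> / s x)"
      using pos q(1) by (intro order_trans[OF abs_triangle_ineq]) (simp add: abs_mult abs_divide)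
    also have "\<dots> \<le> (2 * D) / s x0 + 1 * ((2 * real m * D) / s x0)"
      by (intro add_mono mult_mono frac_le hD sD) (use pos q D0 in simp_all)
    also have "\<dots> = (2 / s x0 + 2 * real m / s x0) * D"
      by (simp add: algebra_simps)
    finally show ?thesis
      using v by (simp add: g_def D_def q_def)
  qed
  moreover have "0 \<le> 2 / s x0 + 2 * real m / s x0"
    using s_pos[OF x0(1)] by simp
  ultimately show ?thesis
    by (intro exI[of _ g] exI[of _ "2 / s x0 + 2 * real m / s x0"]) blast
qed

text \<open>
  The map \<open>f\<close> is homotopic to a Lipschitz map \<open>g\<close>, and \<open>g\<close> misses some point \<open>z\<close> with \<open>z m = 0\<close>. The
  segment from \<open>g x\<close> to \<open>- z\<close> then contains no constant tuple, so that \<open>radial\<close> carries these segments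
  into the boundary of the simplex, where they contract \<open>g\<close> to the point opposite to \<open>z\<close>.
\<close>

lemma low_dimensional_sphere_map_nullhomotopic:
  assumes jm: "j + 3 \<le> m" and f: "continuous_map (nsphere j) (geometric_realization (boundary_complex m)) f"
  shows "\<exists>c. homotopic_with (\<lambda>_. True) (nsphere j) (geometric_realization (boundary_complex m)) f (\<lambda>_. c)"
proof -
  let ?S = "topspace (nsphere j)" and ?B = "geometric_realization (boundary_complex m)"
  have m: "2 \<le> m"
    using jm by simp
  obtain g C where fg: "homotopic_with (\<lambda>_. True) (nsphere j) ?B f g" and C: "0 \<le> C"
    and lip: "\<And>x y v. x \<in> ?S \<Longrightarrow> y \<in> ?S \<Longrightarrow> v \<in> {1..m} \<Longrightarrow> \<bar>g x v - g y v\<bar> \<le> C * (\<Sum>i\<le>j. \<bar>x i - y i\<bar>)"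
    using homotopic_lipschitz_map[OF m f] by blast
  have mp: "m = (m - 2) + 2" and jp: "j < m - 2"
    using jm by auto
  obtain z where z: "\<And>v. v \<in> {1..m} \<Longrightarrow> 0 \<le> z v" "(\<Sum>v=1..m. z v) = 1" "z m = 0"
    and miss: "\<And>x. x \<in> ?S \<Longrightarrow> \<exists>v\<in>{1..m}. g x v \<noteq> z v"
    using lipschitz_sphere_map_misses_point[of j "m - 2" g C, folded mp, OF lip C jp] by blast
  have g: "continuous_map (nsphere j) ?B g"
    using homotopic_with_imp_continuous_maps[OF fg] by blast
  have gS: "g x \<in> topspace ?B" if "x \<in> ?S" for x
    using g that by (auto simp: continuous_map_def)
  define H where "H = (\<lambda>p::real \<times> (nat \<Rightarrow> real). \<lambda>v. (1 - fst p) * g (snd p) v - fst p * z v)"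
  have "continuous_map (prod_topology (top_of_set {0..1}) (nsphere j)) ?B (\<lambda>p. radial m (H p))"
  proof (rule continuous_map_radial[OF m])
    fix v assume v: "v \<in> {1..m}"
    have "continuous_map (nsphere j) euclideanreal (\<lambda>x. g x v)"
      using g v unfolding continuous_map_into_geometric_realization Union_boundary_complex[OF m] by blast
    then have 1: "continuous_map (prod_topology (top_of_set {0..1::real}) (nsphere j)) euclideanreal (\<lambda>p. g (snd p) v)"
      using continuous_map_compose[OF continuous_map_snd] by (auto simp: o_def)
    have 2: "continuous_map (prod_topology (top_of_set {0..1}) (nsphere j)) euclideanreal fst"
      by (rule continuous_map_into_fulltopology[OF continuous_map_fst])
    show "continuous_map (prod_topology (top_of_set {0..1}) (nsphere j)) euclideanreal (\<lambda>p. H p v)"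
      unfolding H_def by (intro continuous_map_diff continuous_map_real_mult 1 2) auto
  next
    fix p assume "p \<in> topspace (prod_topology (top_of_set {0..1::real}) (nsphere j))"
    then have p: "0 \<le> fst p" "fst p \<le> 1" "snd p \<in> ?S"
      by auto
    let ?s = "fst p" and ?x = "snd p"
    have gx: "\<And>v. v \<in> {1..m} \<Longrightarrow> 0 \<le> g ?x v" "(\<Sum>v=1..m. g ?x v) = 1" "\<exists>v\<in>{1..m}. g ?x v = 0"
      using gS[OF p(3)] unfolding topspace_boundary[OF m] by blast+
    show "\<exists>v\<in>{1..m}. \<exists>w\<in>{1..m}. H p v \<noteq> H p w"
    proof (rule ccontr)
      assume "\<not> ?thesis"
      then have eq: "H p v = H p m" if "v \<in> {1..m}" for v
        using that m by (metis atLeastAtMost_iff le_trans one_le_numeral order_refl)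
      \<comment> \<open>The constant value is nonnegative at index \<open>m\<close> and nonpositive at a zero of \<open>g x\<close>,
        hence 0; comparing sums shows that this is the midpoint and that \<open>g x = z\<close>.\<close>
      have "m \<in> {1..m}" using m by simp
      then have "0 \<le> H p m"
        using gx(1) p z(3) by (simp add: H_def)
      moreover obtain v where v: "v \<in> {1..m}" "g ?x v = 0"
        using gx(3) by blast
      then have "H p v \<le> 0"
        using z(1) p by (simp add: H_def)
      ultimately have "H p m = 0"
        using eq[OF v(1)] by simp
      then have *: "(1 - ?s) * g ?x v = ?s * z v" if "v \<in> {1..m}" for v
        using eq[OF that] by (simp add: H_def)
      have "(1 - ?s) * (\<Sum>v=1..m. g ?x v) = ?s * (\<Sum>v=1..m. z v)"
        unfolding sum_distrib_left by (rule sum.cong[OF refl *])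
      then have half: "?s = 1/2"
        using gx(2) z(2) by simp
      have "g ?x v = z v" if "v \<in> {1..m}" for v
        using *[OF that] unfolding half by simp
      then show False
        using miss[OF p(3)] by blast
    qed
  qed
  moreover have "radial m (H (0, x)) = g x" if "x \<in> ?S" for x
    using radial_boundary[OF m gS[OF that]] by (simp add: H_def)
  moreover have "radial m (H (1, x)) = radial m (\<lambda>v. - z v)" for x
    by (simp add: H_def)
  ultimately have "homotopic_with (\<lambda>_. True) (nsphere j) ?B g (\<lambda>_. radial m (\<lambda>v. - z v))"
    by (intro iffD2[OF homotopic_with] refl exI[of _ "\<lambda>p. radial m (H p)"] conjI ballI TrueI) simp_all
  then show ?thesis
    using homotopic_with_trans[OF fg] by blast
qed

text \<open>
  Appending a coordinate \<open>0\<close> identifies \<open>\<real>\<close> to the power \<open>n + 1\<close> with the quotient of \<open>\<real>\<close> to the power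
  \<open>n + 2\<close> by its diagonal, and turns \<open>radial\<close> into a homeomorphism from the sphere. The inverse subtracts the last coordinate.
\<close>

definition sphere_to_boundary :: "nat \<Rightarrow> (nat \<Rightarrow> real) \<Rightarrow> nat \<Rightarrow> real" where
  "sphere_to_boundary n x = radial (n + 2) (\<lambda>v. if v \<le> n + 1 then x (v - 1) else 0)"

definition boundary_to_sphere :: "nat \<Rightarrow> (nat \<Rightarrow> real) \<Rightarrow> nat \<Rightarrow> real" where
  "boundary_to_sphere n t =
     (\<lambda>i. if i \<le> n then (t (i + 1) - t (n + 2)) / sqrt (\<Sum>k\<le>n. (t (k + 1) - t (n + 2))\<^sup>2) else 0)"

lemma sphere_point_not_constant:
  assumes "x \<in> topspace (nsphere n)"
  shows "\<exists>v\<in>{1..n + 2}. \<exists>w\<in>{1..n + 2}.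
    (if v \<le> n + 1 then x (v - 1) else 0) \<noteq> (if w \<le> n + 1 then x (w - 1) else 0)"
proof -
  obtain i where "i \<le> n" "x i \<noteq> 0"
    using assms by (metis (mono_tags, lifting) atMost_iff mem_Collect_eq power_zero_numeral sum.neutral topspace_nsphere zero_neq_one)
  then show ?thesis
    by (intro bexI[of _ "i + 1"] bexI[of _ "n + 2"]) auto
qed

lemma continuous_map_sphere_to_boundary:
  "continuous_map (nsphere n) (geometric_realization (boundary_complex (n + 2))) (sphere_to_boundary n)"
  unfolding sphere_to_boundary_def
proof (rule continuous_map_radial)
  show "continuous_map (nsphere n) euclideanreal (\<lambda>x. if v \<le> n + 1 then x (v - 1) else 0)" for v
    by (cases "v \<le> n + 1") (simp_all add: continuous_map_nsphere_projection)
qed (use sphere_point_not_constant in simp_all)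

lemma boundary_to_sphere_norm_pos:
  assumes "t \<in> topspace (geometric_realization (boundary_complex (n + 2)))"
  shows "0 < (\<Sum>k\<le>n. (t (k + 1) - t (n + 2))\<^sup>2)"
proof (rule ccontr)
  assume "\<not> ?thesis"
  moreover have "0 \<le> (\<Sum>k\<le>n. (t (k + 1) - t (n + 2))\<^sup>2)"
    by (simp add: sum_nonneg)
  ultimately have "(\<Sum>k\<le>n. (t (k + 1) - t (n + 2))\<^sup>2) = 0"
    by linarith
  then have *: "t (k + 1) = t (n + 2)" if "k \<le> n" for k
    using that by (simp add: sum_nonneg_eq_0_iff)
  have "t v = t (n + 2)" if "v \<in> {1..n + 2}" for v
    using *[of "v - 1"] that by (cases "v = n + 2") auto
  moreover have "\<exists>v\<in>{1..n + 2}. \<exists>w\<in>{1..n + 2}. t v \<noteq> t w"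
    by (rule boundary_not_constant[OF _ assms]) simp
  ultimately show False
    by metis
qed

lemma continuous_map_boundary_to_sphere:
  "continuous_map (geometric_realization (boundary_complex (n + 2))) (nsphere n) (boundary_to_sphere n)"
proof -
  let ?B = "geometric_realization (boundary_complex (n + 2))"
  have coord: "continuous_map ?B euclideanreal (\<lambda>t. t v)" if "v \<in> {1..n + 2}" for v
    using that Union_boundary_complex[of "n + 2"] by (intro continuous_map_geometric_realization_coordinate) simp
  let ?N = "\<lambda>t. \<Sum>k\<le>n. (t (k + 1) - t (n + 2))\<^sup>2"
  have "continuous_map ?B euclideanreal ?N"
    by (intro continuous_map_sum continuous_map_real_pow continuous_map_diff coord) auto
  then have root: "continuous_map ?B euclideanreal (\<lambda>t. sqrt (?N t))"
    using continuous_map_compose[of ?B euclideanreal ?N euclideanreal sqrt]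
    by (simp add: o_def continuous_on_real_sqrt)
  have "continuous_map ?B euclideanreal (\<lambda>t. boundary_to_sphere n t i)" for i
  proof (cases "i \<le> n")
    case True
    then have "continuous_map ?B euclideanreal (\<lambda>t. (t (i + 1) - t (n + 2)) / sqrt (?N t))"
      using boundary_to_sphere_norm_pos
      by (intro continuous_map_real_divide continuous_map_diff coord root) (auto simp: less_imp_neq[symmetric])
    then show ?thesis
      using True by (simp add: boundary_to_sphere_def)
  qed (simp add: boundary_to_sphere_def)
  moreover have "(\<Sum>i\<le>n. (boundary_to_sphere n t i)\<^sup>2) = 1" if "t \<in> topspace ?B" for t
  proof -
    have pos: "0 < ?N t"
      by (rule boundary_to_sphere_norm_pos[OF that])
    have "(\<Sum>i\<le>n. (boundary_to_sphere n t i)\<^sup>2) = (\<Sum>i\<le>n. (t (i + 1) - t (n + 2))\<^sup>2 / ?N t)"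
      using pos by (intro sum.cong) (simp_all add: boundary_to_sphere_def power_divide)
    also have "\<dots> = 1"
      using pos by (simp flip: sum_divide_distrib)
    finally show ?thesis .
  qed
  ultimately show ?thesis
    unfolding nsphere by (auto simp: continuous_map_in_subtopology continuous_map_componentwise_UNIV boundary_to_sphere_def)
qed

lemma boundary_to_sphere_inverse:
  assumes x: "x \<in> topspace (nsphere n)"
  shows "boundary_to_sphere n (sphere_to_boundary n x) = x"
proof
  fix i
  define y where "y = (\<lambda>v. if v \<le> n + 1 then x (v - 1) else 0)"
  define d where "d = (\<Sum>w=1..n + 2. y w - Min (y ` {1..n + 2}))"
  have d: "0 < d"
    unfolding d_def by (rule radial_denominator_pos) (use sphere_point_not_constant[OF x] in \<open>simp add: y_def\<close>)
  have diff: "sphere_to_boundary n x (k + 1) - sphere_to_boundary n x (n + 2) = x k / d" if "k \<le> n" for k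
  proof -
    have "sphere_to_boundary n x (k + 1) - sphere_to_boundary n x (n + 2)
        = (y (k + 1) - Min (y ` {1..n + 2})) / d - (y (n + 2) - Min (y ` {1..n + 2})) / d"
      using that unfolding sphere_to_boundary_def radial_def y_def[symmetric] d_def[symmetric] by simp
    also have "\<dots> = (y (k + 1) - y (n + 2)) / d"
      by (simp flip: diff_divide_distrib)
    also have "\<dots> = x k / d"
      using that by (simp add: y_def)
    finally show ?thesis .
  qed
  have "(\<Sum>k\<le>n. (sphere_to_boundary n x (k + 1) - sphere_to_boundary n x (n + 2))\<^sup>2) = (\<Sum>k\<le>n. (x k / d)\<^sup>2)"
    using diff by (intro sum.cong) auto
  also have "\<dots> = (1 / d)\<^sup>2"
    using x by (simp add: power_divide topspace_nsphere flip: sum_divide_distrib)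
  finally have "sqrt (\<Sum>k\<le>n. (sphere_to_boundary n x (k + 1) - sphere_to_boundary n x (n + 2))\<^sup>2) = 1 / d"
    using d by (simp add: real_sqrt_abs)
  then show "boundary_to_sphere n (sphere_to_boundary n x) i = x i"
    using d x diff[of i] by (cases "i \<le> n") (simp_all add: boundary_to_sphere_def topspace_nsphere)
qed

text \<open>
  Restricting such an extension to concentric spheres of shrinking radius would contract the sphere.
\<close>

lemma sphere_identity_not_extendable:
  assumes g: "continuous_map (nball (Suc n)) (nsphere n) g"
    and id: "\<And>x. x \<in> topspace (nsphere n) \<Longrightarrow> g x = x"
  shows False
proof -
  define h where "h = (\<lambda>p::real \<times> (nat \<Rightarrow> real). \<lambda>i. (1 - fst p) * snd p i)"
  have "continuous_map (prod_topology (top_of_set {0..1}) (nsphere n)) (nball (Suc n)) h"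
    unfolding nball_eq continuous_map_in_subtopology continuous_map_componentwise_UNIV
  proof (intro conjI allI)
    fix i
    have 1: "continuous_map (prod_topology (top_of_set {0..1::real}) (nsphere n)) euclideanreal (\<lambda>p. snd p i)"
      using continuous_map_compose[OF continuous_map_snd continuous_map_nsphere_projection] by (auto simp: o_def)
    have 2: "continuous_map (prod_topology (top_of_set {0..1}) (nsphere n)) euclideanreal fst"
      by (rule continuous_map_into_fulltopology[OF continuous_map_fst])
    show "continuous_map (prod_topology (top_of_set {0..1}) (nsphere n)) euclideanreal (\<lambda>p. h p i)"
      unfolding h_def by (intro continuous_map_diff continuous_map_real_mult 1 2) auto
  next
    have "(\<Sum>i<Suc n. (h p i)\<^sup>2) \<le> 1" if p: "0 \<le> fst p" "fst p \<le> 1" "snd p \<in> topspace (nsphere n)" for p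
    proof -
      have "(\<Sum>i<Suc n. (h p i)\<^sup>2) = (1 - fst p)\<^sup>2 * (\<Sum>i\<le>n. (snd p i)\<^sup>2)"
        by (simp only: h_def power_mult_distrib sum_distrib_left lessThan_Suc_atMost)
      also have "\<dots> \<le> 1"
        using p by (simp add: topspace_nsphere abs_square_le_1)
      finally show ?thesis .
    qed
    then show "h \<in> topspace (prod_topology (top_of_set {0..1}) (nsphere n)) \<rightarrow>
        {x. (\<forall>i\<ge>Suc n. x i = 0) \<and> (\<Sum>i<Suc n. (x i)\<^sup>2) \<le> 1}"
      by (auto simp: h_def topspace_nsphere)
  qed
  then have "continuous_map (prod_topology (top_of_set {0..1}) (nsphere n)) (nsphere n) (g \<circ> h)"
    by (rule continuous_map_compose[OF _ g])
  moreover have "(g \<circ> h) (0, x) = id x" if "x \<in> topspace (nsphere n)" for x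
    using id[OF that] by (simp add: h_def)
  moreover have "(g \<circ> h) (1, x) = g (\<lambda>_. 0)" for x
    by (simp add: h_def)
  ultimately have "homotopic_with (\<lambda>_. True) (nsphere n) (nsphere n) id (\<lambda>_. g (\<lambda>_. 0))"
    by (intro iffD2[OF homotopic_with] refl exI[of _ "g \<circ> h"] conjI ballI TrueI) simp_all
  then show False
    using non_contractible_space_nsphere[of n] unfolding contractible_space_def by blast
qed

section \<open>Graphs with property P and colourings of their cones\<close>

lemma pair_graph_symD: "pair_graph T \<Longrightarrow> (x, y) \<in> parcs T \<Longrightarrow> (y, x) \<in> parcs T"
  using pair_sym_digraph.arcs_symmetric pair_graph.axioms(2) pair_pseudo_graph.axioms(2) by metis

lemma pair_graph_irrefl: "pair_graph T \<Longrightarrow> (x, x) \<notin> parcs T"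
  using pair_loopfree_digraph.no_loops' pair_graph.axioms(1) pair_digraph.axioms(2) by metis

lemma pair_graph_arc_verts:
  assumes "pair_graph T" "(x, y) \<in> parcs T"
  shows "x \<in> pverts T" "y \<in> pverts T"
proof -
  interpret pair_graph T by fact
  show "x \<in> pverts T" "y \<in> pverts T"
    using assms(2) by (auto dest: in_arcsD1 in_arcsD2)
qed

text \<open>
  The set of vertices adjacent to \<open>x\<close> or \<open>y\<close> contains \<open>x\<close>, and property \<open>P\<close>, applied to the edge between
  \<open>x\<close> and \<open>y\<close> and to an edge leaving the set, shows that it is closed under adjacency. For connected \<open>T\<close>
  this is everything; equivalently, non-adjacency is transitive and \<open>T\<close> is complete multipartite.
\<close>

lemma property_P_edge_dominates:
  assumes T: "pair_graph T" and conn: "Digraph_Component.connected (with_proj T)" and P: "property_P T"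
    and xy: "(x, y) \<in> parcs T" and z: "z \<in> pverts T"
  shows "(x, z) \<in> parcs T \<or> (y, z) \<in> parcs T"
proof -
  interpret pair_graph T by fact
  note sym = pair_graph_symD[OF T] and irr = pair_graph_irrefl[OF T]
  let ?ok = "\<lambda>z. (x, z) \<in> parcs T \<or> (y, z) \<in> parcs T"
  have step_along_edge: "?ok z'" if "?ok z" "(z, z') \<in> parcs T" for z z'
  proof -
    have P4: "(z', a) \<in> parcs T \<or> (z', b) \<in> parcs T"
      if "(a, b) \<in> parcs T" "(z, a) \<in> parcs T" "{a, b} \<inter> {z, z'} = {}" for a b
      using P that \<open>(z, z') \<in> parcs T\<close> unfolding property_P_def by blast
    show ?thesis
    proof (cases "{x, y} \<inter> {z, z'} = {}")
      case True
      then show ?thesis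
        using P4[of x y] P4[of y x] xy \<open>?ok z\<close> sym by blast
    next
      case False
      then show ?thesis
        using xy \<open>(z, z') \<in> parcs T\<close> sym by blast
    qed
  qed
  have "x \<in> pverts T"
    using pair_graph_arc_verts[OF T xy] by simp
  then have "(x, z) \<in> rtrancl_on (pverts T) (parcs (mk_symmetric (with_proj T)))"
    using conn z unfolding connected_def strongly_connected_def reachable_def by simp
  then show ?thesis
  proof (induction rule: rtrancl_on_induct)
    case base
    then show ?case using xy sym by blast
  next
    case (step u v)
    then have "(u, v) \<in> parcs T"
      using sym by (auto simp: parcs_mk_symmetric)
    then show ?case
      using step.IH step_along_edge by blast
  qed
qed

text \<open>
  Every vertex misses some element of a maximal clique \<open>Q\<close>, itself if it belongs to \<open>Q\<close>. Sending each
  vertex to such an element is a proper colouring: the ends of an edge cannot both be non-adjacent to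
  the same vertex. Hence the chromatic number is at most the size of \<open>Q\<close>.
\<close>

lemma clique_of_edge_dominating:
  assumes T: "pair_graph T" and chi: "m \<le> chromatic_number T"
    and dom: "\<And>x y z. (x, y) \<in> parcs T \<Longrightarrow> z \<in> pverts T \<Longrightarrow> (x, z) \<in> parcs T \<or> (y, z) \<in> parcs T"
  shows "\<exists>q. q \<in> {1..m} \<rightarrow> pverts T \<and> (\<forall>a\<in>{1..m}. \<forall>b\<in>{1..m}. a \<noteq> b \<longrightarrow> (q a, q b) \<in> parcs T)"
proof -
  interpret pair_graph T by fact
  note sym = pair_graph_symD[OF T] and irr = pair_graph_irrefl[OF T]
  define clique where "clique = (\<lambda>Q. Q \<subseteq> pverts T \<and> (\<forall>a\<in>Q. \<forall>b\<in>Q. a \<noteq> b \<longrightarrow> (a, b) \<in> parcs T))"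
  have "clique {}"
    by (simp add: clique_def)
  moreover have "\<forall>Q. clique Q \<longrightarrow> card Q < Suc (card (pverts T))"
    by (auto simp: clique_def less_Suc_eq_le intro: card_mono pair_finite_verts)
  ultimately obtain Q where Q: "clique Q" and max: "\<And>Q'. clique Q' \<Longrightarrow> card Q' \<le> card Q"
    using ex_has_greatest_nat[of clique "{}" card] by (metis less_Suc_eq_le)
  have "finite Q"
    using Q finite_subset[OF _ pair_finite_verts] by (auto simp: clique_def)
  have "\<exists>p\<in>Q. (v, p) \<notin> parcs T" if v: "v \<in> pverts T" for v
  proof (rule ccontr)
    assume "\<not> ?thesis"
    then have all: "(v, p) \<in> parcs T" if "p \<in> Q" for p
      using that by blast
    then have "clique (insert v Q)" "v \<notin> Q"
      using Q v sym irr by (auto simp: clique_def)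
    then show False
      using max[of "insert v Q"] \<open>finite Q\<close> by simp
  qed
  then obtain p where p: "p v \<in> Q" "(v, p v) \<notin> parcs T" if "v \<in> pverts T" for v
    by metis
  obtain h where h: "bij_betw h Q {1..card Q}"
    using ex_bij_betw_finite_nat[OF \<open>finite Q\<close>] bij_betw_same_card ex_bij_betw_nat_finite_1
      finite_same_card_bij[OF \<open>finite Q\<close>, of "{1..card Q}"] by auto
  have proper: "p v \<noteq> p w" if "(v, w) \<in> parcs T" for v w
    using dom[OF that, of "p v"] p[of v] p[of w] pair_graph_arc_verts[OF T that] Q
    by (auto simp: clique_def)
  have hp: "h (p v) \<in> {1..card Q}" if "v \<in> pverts T" for v
    using bij_betwE[OF h] p(1)[OF that] by blast
  have "h (p v) \<noteq> h (p w)" if "(v, w) \<in> parcs T" for v w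
    using inj_onD[OF bij_betw_imp_inj_on[OF h], of "p v" "p w"] proper[OF that]
      p(1) pair_graph_arc_verts[OF T that] by blast
  then have "graph_hom T (complete_graph (card Q)) (h \<circ> p)"
    using hp pair_graph_arc_verts[OF T] by (simp add: graph_hom_def complete_graph_def Pi_iff case_prod_unfold)
  then have "chromatic_number T \<le> card Q"
    unfolding chromatic_number_def by (blast intro: Least_le)
  then have le: "m \<le> card Q"
    using chi by simp
  have inv: "bij_betw (inv_into Q h) {1..card Q} Q"
    by (rule bij_betw_inv_into[OF h])
  show ?thesis
  proof (intro exI[of _ "inv_into Q h"] conjI ballI impI)
    have in_Q: "inv_into Q h a \<in> Q" if "a \<in> {1..m}" for a
      using bij_betwE[OF inv] that le by auto
    then show "inv_into Q h \<in> {1..m} \<rightarrow> pverts T"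
      using Q by (auto simp: clique_def)
    fix a b assume "a \<in> {1..m}" "b \<in> {1..m}" "a \<noteq> b"
    moreover from this have "inv_into Q h a \<noteq> inv_into Q h b"
      using inj_onD[OF bij_betw_imp_inj_on[OF inv], of a b] le by auto
    ultimately have "inv_into Q h a \<in> Q" "inv_into Q h b \<in> Q" "inv_into Q h a \<noteq> inv_into Q h b"
      using in_Q by blast+
    then show "(inv_into Q h a, inv_into Q h b) \<in> parcs T"
      using Q by (auto simp: clique_def)
  qed
qed

text \<open>
  What is left of the assumptions on \<open>T\<close>: edges dominate all vertices, and there is a clique with \<open>m\<close>
  vertices.
\<close>

locale dominated_cone =
  fixes T :: "'a pair_pre_digraph" and m r i :: nat and q :: "nat \<Rightarrow> 'a"
  assumes T: "pair_graph T"
    and dom: "\<And>x y z. (x, y) \<in> parcs T \<Longrightarrow> z \<in> pverts T \<Longrightarrow> (x, z) \<in> parcs T \<or> (y, z) \<in> parcs T"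
    and q_verts: "\<And>a. a \<in> {1..m} \<Longrightarrow> q a \<in> pverts T"
    and q_clique: "\<And>a b. a \<in> {1..m} \<Longrightarrow> b \<in> {1..m} \<Longrightarrow> a \<noteq> b \<Longrightarrow> (q a, q b) \<in> parcs T"
    and m: "2 \<le> m" and r: "i < r"
begin

abbreviation G where "G \<equiv> cone_graph T r {0..i}"
abbreviation H where "H \<equiv> exponential_graph (complete_graph m) G"
abbreviation L where "L \<equiv> parcs (looped_path r {0..i})"

text \<open>
  The vertex of the cone that represents \<open>v\<close> on level \<open>j\<close>. The vertices on level \<open>r\<close> coincide, so
  statements about levels include the apex without a case distinction.
\<close>

definition pt :: "'a \<Rightarrow> nat \<Rightarrow> ('a \<times> nat) set" where
  "pt v j = (if j < r then {(v, j)} else pverts T \<times> {r})"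

lemma edge: "(q 1, q 2) \<in> parcs T"
  using q_clique[of 1 2] m by simp

lemma L_iff: "(j, k) \<in> L \<longleftrightarrow> j \<le> r \<and> k \<le> r \<and> (k = j + 1 \<or> j = k + 1 \<or> (j = k \<and> j \<le> i))"
  using r by (auto simp: looped_path_def)

lemma pverts_G: "pverts G = {pt v j | v j. v \<in> pverts T \<and> j \<le> r}"
proof -
  define R where "R = top_level_rel (pverts T \<times> {0..r}) r"
  have "R `` {(v, j)} = pt v j" if "v \<in> pverts T" "j \<le> r" for v j
    using that by (auto simp: R_def top_level_rel_def pt_def)
  moreover have "pverts G = (\<lambda>p. R `` {p}) ` (pverts T \<times> {0..r})"
    by (auto simp: cone_graph_def quotient_graph_def categorical_product_def looped_path_def quotient_def R_def)
  ultimately show ?thesis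
    by (force simp: image_iff)
qed

lemma pt_in: "v \<in> pverts T \<Longrightarrow> j \<le> r \<Longrightarrow> pt v j \<in> pverts G"
  by (auto simp: pverts_G)

lemma parcs_G:
  "(X, Y) \<in> parcs G \<longleftrightarrow> X \<in> pverts G \<and> Y \<in> pverts G \<and>
     (\<exists>x\<in>X. \<exists>y\<in>Y. (fst x, fst y) \<in> parcs T \<and> (snd x, snd y) \<in> L)"
  by (simp add: cone_graph_def quotient_graph_def categorical_product_def case_prod_unfold)

lemma arc_G_iff: "(X, Y) \<in> parcs G \<longleftrightarrow> (\<exists>v w j k. (v, w) \<in> parcs T \<and> (j, k) \<in> L \<and> X = pt v j \<and> Y = pt w k)"
  (is "_ \<longleftrightarrow> ?R")
proof
  have mem: "X = pt (fst x) (snd x)" if "X \<in> pverts G" "x \<in> X" for X x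
    using that by (auto simp: pverts_G pt_def split: if_splits)
  assume "(X, Y) \<in> parcs G"
  then show ?R
    unfolding parcs_G using mem by metis
next
  assume ?R
  then obtain v w j k where *: "(v, w) \<in> parcs T" "(j, k) \<in> L" "X = pt v j" "Y = pt w k"
    by metis
  have verts: "v \<in> pverts T" "w \<in> pverts T" "j \<le> r" "k \<le> r"
    using * pair_graph_arc_verts[OF T] by (auto simp: L_iff)
  have "(v, j) \<in> X" "(w, k) \<in> Y"
    using *(3,4) verts by (auto simp: pt_def)
  then have "\<exists>x\<in>X. \<exists>y\<in>Y. (fst x, fst y) \<in> parcs T \<and> (snd x, snd y) \<in> L"
    using *(1,2) by (intro bexI[of _ "(v, j)"] bexI[of _ "(w, k)"]) simp_all
  then show "(X, Y) \<in> parcs G"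
    unfolding parcs_G using *(3,4) pt_in verts by blast
qed

lemma finite_pverts_G: "finite (pverts G)"
proof -
  interpret pair_graph T by (rule T)
  have "pverts G \<subseteq> (\<lambda>(v, j). pt v j) ` (pverts T \<times> {0..r})"
    by (force simp: pverts_G)
  then show ?thesis
    by (rule finite_subset) (simp add: pair_finite_verts)
qed

lemma pverts_H: "pverts H = pverts G \<rightarrow>\<^sub>E {1..m}"
  by (simp add: exponential_graph_def complete_graph_def)

lemma finite_pverts_H: "finite (pverts H)"
  unfolding pverts_H by (rule finite_PiE[OF finite_pverts_G]) simp

lemma H_value: "f \<in> pverts H \<Longrightarrow> v \<in> pverts T \<Longrightarrow> j \<le> r \<Longrightarrow> f (pt v j) \<in> {1..m}"
  unfolding pverts_H by (rule PiE_mem[OF _ pt_in])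

lemma arc_H_iff:
  "(f, f') \<in> parcs H \<longleftrightarrow> f \<in> pverts H \<and> f' \<in> pverts H \<and>
     (\<forall>v w j k. (v, w) \<in> parcs T \<longrightarrow> (j, k) \<in> L \<longrightarrow> f (pt v j) \<noteq> f' (pt w k))"
proof -
  have range: "f (pt v j) \<in> {1..m} \<and> f' (pt w k) \<in> {1..m}"
    if "f \<in> pverts H" "f' \<in> pverts H" "(v, w) \<in> parcs T" "(j, k) \<in> L" for v w j k
    using that H_value pair_graph_arc_verts[OF T that(3)] by (simp add: L_iff)
  have "(f, f') \<in> parcs H \<longleftrightarrow> f \<in> pverts H \<and> f' \<in> pverts H \<and>
     (\<forall>X Y. (X, Y) \<in> parcs G \<longrightarrow> f X \<in> {1..m} \<and> f' Y \<in> {1..m} \<and> f X \<noteq> f' Y)"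
    by (simp add: exponential_graph_def complete_graph_def case_prod_unfold Ball_def)
  also have "\<dots> \<longleftrightarrow> f \<in> pverts H \<and> f' \<in> pverts H \<and>
     (\<forall>v w j k. (v, w) \<in> parcs T \<longrightarrow> (j, k) \<in> L \<longrightarrow> f (pt v j) \<noteq> f' (pt w k))"
  proof (intro conj_cong refl iffI allI impI)
    fix v w j k
    assume "\<forall>X Y. (X, Y) \<in> parcs G \<longrightarrow> f X \<in> {1..m} \<and> f' Y \<in> {1..m} \<and> f X \<noteq> f' Y"
      and "(v, w) \<in> parcs T" "(j, k) \<in> L"
    moreover from this have "(pt v j, pt w k) \<in> parcs G"
      by (intro iffD2[OF arc_G_iff] exI[of _ v] exI[of _ w] exI[of _ j] exI[of _ k]) simp
    ultimately show "f (pt v j) \<noteq> f' (pt w k)"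
      by simp
  next
    fix X Y
    assume H: "f \<in> pverts H" "f' \<in> pverts H"
      and ne: "\<forall>v w j k. (v, w) \<in> parcs T \<longrightarrow> (j, k) \<in> L \<longrightarrow> f (pt v j) \<noteq> f' (pt w k)"
      and XY: "(X, Y) \<in> parcs G"
    obtain v w j k where "(v, w) \<in> parcs T" "(j, k) \<in> L" "X = pt v j" "Y = pt w k"
      using XY unfolding arc_G_iff by metis
    then show "f X \<in> {1..m} \<and> f' Y \<in> {1..m} \<and> f X \<noteq> f' Y"
      using range[OF H] ne by simp
  qed
  finally show ?thesis .
qed

lemma arc_H_sym: "(f, f') \<in> parcs H \<Longrightarrow> (f', f) \<in> parcs H"
  unfolding arc_H_iff using pair_graph_symD[OF T] by (metis L_iff)

text \<open>
  A proper colouring uses each colour exactly once on the clique, and a vertex \<open>w\<close> is non-adjacent to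
  exactly one vertex of the clique, namely the one with the colour of \<open>w\<close>. All other colours occur
  among the neighbours of \<open>w\<close>.
\<close>

lemma proper_colouring_rigid:
  assumes g: "\<And>v. v \<in> pverts T \<Longrightarrow> g v \<in> {1..m}" and g': "g' w \<in> {1..m}" and w: "w \<in> pverts T"
    and proper: "\<And>u v. (u, v) \<in> parcs T \<Longrightarrow> g u \<noteq> g v"
    and arc: "\<And>v. (v, w) \<in> parcs T \<Longrightarrow> g v \<noteq> g' w"
  shows "g' w = g w"
proof -
  have "inj_on (g \<circ> q) {1..m}"
  proof (rule inj_onI, rule ccontr)
    fix a b assume "a \<in> {1..m}" "b \<in> {1..m}" "(g \<circ> q) a = (g \<circ> q) b" "a \<noteq> b"
    then show False
      using proper[OF q_clique, of a b] by simp
  qed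
  moreover have "(g \<circ> q) ` {1..m} \<subseteq> {1..m}"
    using g q_verts by auto
  ultimately have onto: "(g \<circ> q) ` {1..m} = {1..m}"
    by (intro endo_inj_surj finite_atLeastAtMost)
  obtain a where a: "a \<in> {1..m}" "g (q a) = g' w"
    using onto g' by (metis (no_types, lifting) comp_apply imageE)
  obtain b where b: "b \<in> {1..m}" "g (q b) = g w"
    using onto g[OF w] by (metis (no_types, lifting) comp_apply imageE)
  have "(q a, w) \<notin> parcs T" "(q b, w) \<notin> parcs T"
    using a b arc proper by metis+
  then have "a = b"
    using dom[OF q_clique w] a b by blast
  then show ?thesis
    using a b by simp
qed

text \<open>
  On the apex all colours agree, so the claim holds for \<open>j = r\<close>. If \<open>f\<close> were proper on level \<open>j\<close>, then by
  rigidity \<open>f'\<close> would be the same proper colouring on level \<open>j + 1\<close>, contrary to the claim for that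
  level with \<open>f\<close> and \<open>f'\<close> exchanged.
\<close>

lemma level_not_proper:
  assumes "j \<le> r" "(f, f') \<in> parcs H"
  shows "\<exists>(u, w) \<in> parcs T. f (pt u j) = f (pt w j)"
  using assms
proof (induction j arbitrary: f f' rule: inc_induct)
  case base
  then show ?case
    using edge by (auto simp: pt_def)
next
  case (step j)
  show ?case
  proof (rule ccontr)
    assume "\<not> ?case"
    then have proper: "f (pt u j) \<noteq> f (pt w j)" if "(u, w) \<in> parcs T" for u w
      using that by blast
    have "f' (pt w (Suc j)) = f (pt w j)" if "w \<in> pverts T" for w
    proof (rule proper_colouring_rigid[of "\<lambda>v. f (pt v j)" "\<lambda>v. f' (pt v (Suc j))"])
      show "f (pt v j) \<noteq> f' (pt w (Suc j))" if "(v, w) \<in> parcs T" for v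
        using step.prems that step.hyps unfolding arc_H_iff by (auto simp: L_iff)
    qed (use step that proper H_value in \<open>auto simp: arc_H_iff\<close>)
    moreover obtain u w where "(u, w) \<in> parcs T" "f' (pt u (Suc j)) = f' (pt w (Suc j))"
      using step.IH[OF arc_H_sym[OF step.prems]] by blast
    ultimately show False
      using proper pair_graph_arc_verts[OF T] by metis
  qed
qed

text \<open>
  On level \<open>r\<close> every edge is monochromatic, and this is the colour of the apex. On a level that is
  properly coloured the value is arbitrary.
\<close>

definition col :: "nat \<Rightarrow> (('a \<times> nat) set \<Rightarrow> nat) \<Rightarrow> nat" where
  "col j f = (SOME c. \<exists>(u, w) \<in> parcs T. f (pt u j) = c \<and> f (pt w j) = c)"

lemma col_edge:
  assumes "j \<le> r" "(f, f') \<in> parcs H"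
  obtains u w where "(u, w) \<in> parcs T" "f (pt u j) = col j f" "f (pt w j) = col j f"
proof -
  have "\<exists>c. \<exists>(u, w) \<in> parcs T. f (pt u j) = c \<and> f (pt w j) = c"
    using level_not_proper[OF assms] by auto
  then have "\<exists>(u, w) \<in> parcs T. f (pt u j) = col j f \<and> f (pt w j) = col j f"
    unfolding col_def by (rule someI_ex)
  then show ?thesis
    using that by blast
qed

lemma col_range: "j \<le> r \<Longrightarrow> (f, f') \<in> parcs H \<Longrightarrow> col j f \<in> {1..m}"
  by (metis col_edge H_value arc_H_iff pair_graph_arc_verts(1)[OF T])

text \<open>
  One end of the monochromatic edge is adjacent to \<open>v\<close>, so every vertex sees the chosen colour.
\<close>

lemma col_neighbour:
  assumes "j \<le> r" "(f, f') \<in> parcs H" "v \<in> pverts T"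
  obtains u where "(u, v) \<in> parcs T" "f (pt u j) = col j f"
  using col_edge[OF assms(1,2)] dom assms(3) by metis

definition level :: "('a \<times> nat) set \<Rightarrow> nat" where
  "level X = snd (SOME p. p \<in> X)"

lemma level_pt: "v \<in> pverts T \<Longrightarrow> j \<le> r \<Longrightarrow> level (pt v j) = j"
proof -
  assume v: "v \<in> pverts T" "j \<le> r"
  have "(SOME p. p \<in> pt v j) \<in> pt v j"
    by (rule someI[of _ "(v, j)"]) (use v in \<open>auto simp: pt_def\<close>)
  then show ?thesis
    using v by (auto simp: level_def pt_def split: if_splits)
qed

definition levelwise :: "(nat \<Rightarrow> nat) \<Rightarrow> ('a \<times> nat) set \<Rightarrow> nat" where
  "levelwise a = (\<lambda>X\<in>pverts G. a (level X))"

lemma levelwise_pt: "v \<in> pverts T \<Longrightarrow> j \<le> r \<Longrightarrow> levelwise a (pt v j) = a j"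
  by (simp add: levelwise_def pt_in level_pt)

lemma levelwise_in_H: "(\<And>j. j \<le> r \<Longrightarrow> a j \<in> {1..m}) \<Longrightarrow> levelwise a \<in> pverts H"
  unfolding pverts_H by (auto simp: levelwise_def pverts_G level_pt)

lemma levelwise_cong: "(\<And>j. j \<le> r \<Longrightarrow> a j = b j) \<Longrightarrow> levelwise a = levelwise b"
  unfolding levelwise_def by (rule restrict_ext) (auto simp: pverts_G level_pt)

lemma arc_levelwise:
  assumes "\<And>j. j \<le> r \<Longrightarrow> a j \<in> {1..m}" "\<And>j. j \<le> r \<Longrightarrow> b j \<in> {1..m}"
    and "\<And>j k. (j, k) \<in> L \<Longrightarrow> a j \<noteq> b k"
  shows "(levelwise a, levelwise b) \<in> parcs H"
  unfolding arc_H_iff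
  using assms levelwise_in_H pair_graph_arc_verts[OF T] by (auto simp: levelwise_pt L_iff)

text \<open>
  Every vertex already sees the colours \<open>col j f\<close> of \<open>f\<close>, so making \<open>f\<close> constant on each level does not
  add any colour to be avoided by a neighbour of \<open>f\<close>.
\<close>

lemma fold_to_levelwise:
  assumes "(f, f') \<in> parcs H"
  shows "(levelwise (\<lambda>j. col j f), f') \<in> parcs H"
  unfolding arc_H_iff
proof (intro conjI allI impI)
  show "levelwise (\<lambda>j. col j f) \<in> pverts H"
    by (rule levelwise_in_H) (rule col_range[OF _ assms])
  show "f' \<in> pverts H"
    using assms by (simp add: arc_H_iff)
  fix v w j k assume vw: "(v, w) \<in> parcs T" and jk: "(j, k) \<in> L"
  have jr: "j \<le> r" and v: "v \<in> pverts T" "w \<in> pverts T"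
    using jk pair_graph_arc_verts[OF T vw] by (auto simp: L_iff)
  obtain u where "(u, w) \<in> parcs T" "f (pt u j) = col j f"
    using col_neighbour[OF jr assms v(2)] .
  then show "levelwise (\<lambda>j. col j f) (pt v j) \<noteq> f' (pt w k)"
    using assms jk unfolding levelwise_pt[OF v(1) jr] arc_H_iff by metis
qed

lemma col_arc:
  assumes "(f, f') \<in> parcs H" "(j, k) \<in> L"
  shows "col j f \<noteq> col k f'"
proof -
  have "(levelwise (\<lambda>j. col j f), levelwise (\<lambda>j. col j f')) \<in> parcs H"
    using fold_to_levelwise[OF arc_H_sym[OF fold_to_levelwise[OF assms(1)]]] arc_H_sym by blast
  then have "levelwise (\<lambda>j. col j f) (pt (q 1) j) \<noteq> levelwise (\<lambda>j. col j f') (pt (q 2) k)"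
    using edge assms(2) unfolding arc_H_iff by blast
  then show ?thesis
    using pair_graph_arc_verts[OF T edge] assms(2) by (simp add: levelwise_pt L_iff)
qed

lemma loopless_H: "(f, f) \<notin> parcs H"
  using col_arc[of f f 0 0] by (auto simp: L_iff)

lemma pair_graph_H: "pair_graph H"
proof -
  have sub: "parcs H \<subseteq> pverts H \<times> pverts H"
    by (auto simp: arc_H_iff)
  have "finite (parcs H)"
    by (rule finite_subset[OF sub]) (simp add: finite_pverts_H)
  moreover have "symmetric (with_proj H)"
    using arc_H_sym by (auto simp: symmetric_def sym_def)
  moreover have "fst e \<noteq> snd e" if "e \<in> parcs H" for e
    using that loopless_H by (metis prod.collapse)
  ultimately show ?thesis
    using sub finite_pverts_H by unfold_locales auto
qed

definition const :: "nat \<Rightarrow> ('a \<times> nat) set \<Rightarrow> nat" where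
  "const c = levelwise (\<lambda>_. c)"

lemma const_in_H: "c \<in> {1..m} \<Longrightarrow> const c \<in> pverts H"
  unfolding const_def by (rule levelwise_in_H)

lemma arc_const: "c \<in> {1..m} \<Longrightarrow> d \<in> {1..m} \<Longrightarrow> c \<noteq> d \<Longrightarrow> (const c, const d) \<in> parcs H"
  unfolding const_def by (rule arc_levelwise) auto

lemma col_const: "c \<in> {1..m} \<Longrightarrow> col 0 (const c) = c"
proof -
  assume c: "c \<in> {1..m}"
  obtain d where "d \<in> {1..m}" "d \<noteq> c"
    using m by (intro that[of "if c = 1 then 2 else 1"]) auto
  then obtain u w where "(u, w) \<in> parcs T" "const c (pt u 0) = col 0 (const c)"
    using col_edge[OF _ arc_const[OF c], of 0] by blast
  then show ?thesis
    using pair_graph_arc_verts[OF T] by (auto simp: const_def levelwise_pt)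
qed

text \<open>
  The colour \<open>col 0\<close> is proper because of the loop at \<open>0\<close>. It is meaningless on isolated vertices of
  \<open>H\<close>, which receive the colour \<open>1\<close>. Conversely the constant maps form a clique with \<open>m\<close> vertices.
\<close>

lemma chromatic_number_H: "chromatic_number H = m"
  unfolding chromatic_number_def
proof (rule Least_equality)
  define g where "g = (\<lambda>f. if \<exists>f'. (f, f') \<in> parcs H then col 0 f else 1)"
  have "g f \<in> {1..m}" for f
    using col_range[of 0 f] m by (auto simp: g_def)
  moreover have "g f \<noteq> g f'" if "(f, f') \<in> parcs H" for f f'
    using col_arc[OF that, of 0 0] that arc_H_sym[OF that] by (auto simp: g_def L_iff)
  ultimately show "\<exists>f. graph_hom H (complete_graph m) f"
    by (intro exI[of _ g]) (auto simp: graph_hom_def complete_graph_def)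
next
  fix n assume "\<exists>f. graph_hom H (complete_graph n) f"
  then obtain f where f: "graph_hom H (complete_graph n) f" by blast
  have "inj_on (\<lambda>c. f (const c)) {1..m}"
  proof (rule inj_onI, rule ccontr)
    fix c d assume "c \<in> {1..m}" "d \<in> {1..m}" and eq: "f (const c) = f (const d)" and "c \<noteq> d"
    then have "(const c, const d) \<in> parcs H" by (intro arc_const)
    then show False
      using f eq by (auto simp: graph_hom_def complete_graph_def)
  qed
  moreover have "(\<lambda>c. f (const c)) ` {1..m} \<subseteq> {1..n}"
    using f const_in_H by (auto simp: graph_hom_def complete_graph_def Pi_iff)
  ultimately have "card {1..m} \<le> card {1..n}"
    by (intro card_inj_on_le) auto
  then show "m \<le> n" by simp
qed

text \<open>
  Folding of the looped path onto \<open>{0..k}\<close>. As long as \<open>k\<close> carries a loop, everything above it can be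
  sent to \<open>k\<close>. Otherwise the part above \<open>k\<close> is wrapped around the edge between \<open>k - 1\<close> and \<open>k\<close>, which
  respects parity. Both foldings fix the looped vertices below \<open>k\<close>.
\<close>

definition fold_path :: "nat \<Rightarrow> nat \<Rightarrow> nat" where
  "fold_path k j = (if j \<le> k then j else if k \<le> i \<or> even (j - k) then k else k - 1)"

lemma fold_path_le: "k \<le> r \<Longrightarrow> fold_path k j \<le> r"
  by (auto simp: fold_path_def)

lemma fold_path_id: "j \<le> r \<Longrightarrow> fold_path r j = j"
  by (simp add: fold_path_def)

lemma fold_path_0: "fold_path 0 j = 0"
  by (simp add: fold_path_def)

lemma fold_path_hom: "(j, j') \<in> L \<Longrightarrow> k \<le> r \<Longrightarrow> (fold_path k j, fold_path k j') \<in> L"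
  unfolding L_iff fold_path_def by (cases "k \<le> i"; cases "j \<le> k"; cases "j' \<le> k"; simp; presburger)

text \<open>
  Consecutive foldings send adjacent vertices to adjacent vertices; this is what makes the induced maps
  on the exponential graph contiguous.
\<close>

lemma fold_path_step: "(j, j') \<in> L \<Longrightarrow> Suc k \<le> r \<Longrightarrow> (fold_path (Suc k) j, fold_path k j') \<in> L"
  unfolding L_iff fold_path_def by (cases "k \<le> i"; cases "k = i"; cases "j \<le> k"; cases "j' \<le> k"; simp; presburger)

abbreviation NH where "NH \<equiv> neighborhood_complex H"

definition flatten :: "nat \<Rightarrow> (('a \<times> nat) set \<Rightarrow> nat) \<Rightarrow> ('a \<times> nat) set \<Rightarrow> nat" where
  "flatten k f = levelwise (\<lambda>j. col (fold_path k j) f)"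

lemma NH_I:
  assumes "\<And>f. f \<in> A \<Longrightarrow> (x, f) \<in> parcs H" "x \<in> pverts H"
  shows "A \<in> NH"
proof -
  have "f \<in> pverts H" if "f \<in> A" for f
    using assms(1)[OF that] arc_H_iff[of x f] by simp
  then show ?thesis
    using assms unfolding neighborhood_complex_def by blast
qed

lemma NH_D: "A \<in> NH \<Longrightarrow> \<exists>x\<in>pverts H. \<forall>f\<in>A. (x, f) \<in> parcs H"
  unfolding neighborhood_complex_def by blast

lemma finite_Union_NH: "finite (\<Union>NH)"
  by (rule finite_subset[OF _ finite_pverts_H]) (auto simp: neighborhood_complex_def)

lemma NH_down: "A \<in> NH \<Longrightarrow> B \<subseteq> A \<Longrightarrow> B \<in> NH"
  unfolding neighborhood_complex_def by blast

lemma arc_flatten: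
  assumes "(x, f) \<in> parcs H" "k \<le> r" "l \<le> r"
    and "\<And>j j'. (j, j') \<in> L \<Longrightarrow> (fold_path k j, fold_path l j') \<in> L"
  shows "(flatten k x, flatten l f) \<in> parcs H"
  unfolding flatten_def
proof (rule arc_levelwise)
  show "col (fold_path k j) x \<in> {1..m}" for j
    using col_range[OF fold_path_le assms(1)] assms(2) by simp
  show "col (fold_path l j) f \<in> {1..m}" for j
    using col_range[OF fold_path_le arc_H_sym[OF assms(1)]] assms(3) by simp
  show "col (fold_path k j) x \<noteq> col (fold_path l j') f" if "(j, j') \<in> L" for j j'
    using col_arc[OF assms(1)] assms(4)[OF that] by simp
qed

lemma flatten_r: "flatten r f = levelwise (\<lambda>j. col j f)"
  unfolding flatten_def by (rule levelwise_cong) (simp add: fold_path_id)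

lemma flatten_0: "flatten 0 f = const (col 0 f)"
  by (simp add: flatten_def const_def fold_path_0)

text \<open>
  A common neighbour of some vertices of \<open>H\<close> is also a neighbour of their levelwise versions.
\<close>

lemma id_contiguous_flatten:
  assumes "A \<in> NH" shows "id ` A \<union> flatten r ` A \<in> NH"
proof -
  obtain x where x: "x \<in> pverts H" "\<And>f. f \<in> A \<Longrightarrow> (x, f) \<in> parcs H"
    using NH_D[OF assms] by blast
  then show ?thesis
    by (intro NH_I[of _ x]) (auto simp: flatten_r intro: arc_H_sym fold_to_levelwise)
qed

text \<open>
  If \<open>x\<close> is a common neighbour of the vertices in \<open>A\<close>, then folding \<open>x\<close> as well gives a common neighbour
  of both families of folded vertices.
\<close>

lemma flatten_contiguous:
  assumes "A \<in> NH" "Suc k \<le> r" shows "flatten (Suc k) ` A \<union> flatten k ` A \<in> NH"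
proof (cases "A = {}")
  case False
  obtain x where x: "x \<in> pverts H" "\<And>f. f \<in> A \<Longrightarrow> (x, f) \<in> parcs H"
    using NH_D[OF assms(1)] by blast
  have *: "(flatten (Suc k) x, f) \<in> parcs H" if "f \<in> flatten (Suc k) ` A \<union> flatten k ` A" for f
    using that x(2) assms(2) by (auto intro!: arc_flatten fold_path_hom fold_path_step)
  then show ?thesis
    using False by (intro NH_I[of _ "flatten (Suc k) x"]) (auto simp: arc_H_iff)
qed (use assms in simp)

abbreviation NK where "NK \<equiv> neighborhood_complex (complete_graph m)"

lemma col_simplicial:
  assumes "A \<in> NH" shows "col 0 ` A \<in> NK"
proof (cases "A = {}")
  case False
  obtain x where x: "x \<in> pverts H" "\<And>f. f \<in> A \<Longrightarrow> (x, f) \<in> parcs H"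
    using NH_D[OF assms] by blast
  have 1: "col 0 f \<in> {1..m} \<and> col 0 x \<in> {1..m} \<and> col 0 x \<noteq> col 0 f" if "f \<in> A" for f
    using col_arc[OF x(2)[OF that], of 0 0] col_range[OF _ x(2)[OF that], of 0]
      col_range[OF _ arc_H_sym[OF x(2)[OF that]], of 0] by (simp add: L_iff)
  then have "col 0 ` A \<subseteq> {1..m}" "col 0 x \<in> {1..m}" "\<forall>a\<in>col 0 ` A. a \<in> {1..m} \<and> col 0 x \<noteq> a"
    using False by blast+
  then show ?thesis
    unfolding neighborhood_complex_def complete_graph_def by auto
qed (use m in \<open>auto simp: neighborhood_complex_def complete_graph_def\<close>)

lemma const_simplicial:
  assumes "B \<in> NK" shows "const ` B \<in> NH"
proof -
  obtain x where "x \<in> {1..m}" "\<And>b. b \<in> B \<Longrightarrow> b \<in> {1..m} \<and> x \<noteq> b"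
    using assms unfolding neighborhood_complex_def complete_graph_def by auto
  then show ?thesis
    by (intro NH_I[of _ "const x"]) (auto intro!: arc_const const_in_H)
qed

section \<open>Connectivity of the neighborhood complex\<close>

lemma flatten_homotopic:
  assumes "k \<le> r"
  shows "homotopic_with (\<lambda>_. True) (geometric_realization NH) (geometric_realization NH)
    (realization_map NH NH id) (realization_map NH NH (flatten k))"
  using assms
proof (induction k rule: inc_induct)
  case base
  show ?case
    by (rule homotopic_with_contiguous[OF finite_Union_NH finite_Union_NH NH_down id_contiguous_flatten])
next
  case (step k)
  have "Suc k \<le> r"
    using step.hyps by simp
  then have "homotopic_with (\<lambda>_. True) (geometric_realization NH) (geometric_realization NH)
    (realization_map NH NH (flatten (Suc k))) (realization_map NH NH (flatten k))"
    by (intro homotopic_with_contiguous[OF finite_Union_NH finite_Union_NH NH_down flatten_contiguous])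
  then show ?case
    by (rule homotopic_with_trans[OF step.IH])
qed

lemma Union_NK: "\<Union>NK = {1..m}"
  by (rule Union_boundary_complex[OF m])

lemma NK_down: "A \<in> NK \<Longrightarrow> B \<subseteq> A \<Longrightarrow> B \<in> NK"
  unfolding in_boundary_complex_iff by blast

lemma continuous_map_col: "continuous_map (geometric_realization NH) (geometric_realization NK) (realization_map NH NK (col 0))"
  by (rule continuous_map_realization_map[OF finite_Union_NH _ NK_down col_simplicial])
    (simp_all only: Union_NK finite_atLeastAtMost)

lemma continuous_map_const: "continuous_map (geometric_realization NK) (geometric_realization NH) (realization_map NK NH const)"
  by (rule continuous_map_realization_map[OF _ finite_Union_NH NH_down const_simplicial])
    (simp_all only: Union_NK finite_atLeastAtMost)

lemma col_image: "col 0 ` \<Union>NH \<subseteq> \<Union>NK"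
  using col_simplicial unfolding image_Union by (intro Union_mono) blast

lemma const_image: "const ` \<Union>NK \<subseteq> \<Union>NH"
  using const_simplicial unfolding image_Union by (intro Union_mono) blast

lemma id_homotopic_const_col:
  "homotopic_with (\<lambda>_. True) (geometric_realization NH) (geometric_realization NH)
    (realization_map NH NH id) (realization_map NK NH const \<circ> realization_map NH NK (col 0))"
proof -
  have "flatten 0 = const \<circ> col 0"
    by (rule ext) (simp add: flatten_0)
  moreover have "realization_map NH NH (const \<circ> col 0) = realization_map NK NH const \<circ> realization_map NH NK (col 0)"
  proof
    fix t
    have "finite (\<Union>NK)"
      by (simp only: Union_NK finite_atLeastAtMost)
    then show "realization_map NH NH (const \<circ> col 0) t = (realization_map NK NH const \<circ> realization_map NH NK (col 0)) t"
      unfolding o_apply[of "realization_map NK NH const"]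
      by (intro realization_map_compose[symmetric] finite_Union_NH col_image)
  qed
  ultimately show ?thesis
    using flatten_homotopic[of 0] by (simp only: le0)
qed

lemma col_const_realization:
  assumes "t \<in> topspace (geometric_realization NK)"
  shows "realization_map NH NK (col 0) (realization_map NK NH const t) = t"
proof -
  have fin: "finite (\<Union>NK)"
    by (simp only: Union_NK finite_atLeastAtMost)
  have "realization_map NH NK (col 0) (realization_map NK NH const t) = realization_map NK NK (col 0 \<circ> const) t"
    by (rule realization_map_compose[OF fin finite_Union_NH const_image])
  also have "\<dots> = t"
    by (rule realization_map_cong_id[OF fin _ assms]) (simp only: Union_NK o_apply col_const)
  finally show ?thesis .
qed

text \<open>
  A map \<open>f\<close> from a sphere is homotopic to \<open>\<iota> \<circ> \<pi> \<circ> f\<close>, and \<open>\<pi> \<circ> f\<close> is null-homotopic by dimension.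
\<close>

lemma k_connected_NH: "k_connected (int m - 3) (geometric_realization NH)"
  unfolding k_connected_def
proof (intro allI impI)
  fix j :: nat and f
  assume "int j \<le> int m - 3" and f: "continuous_map (nsphere j) (geometric_realization NH) f"
  then have jm: "j + 3 \<le> m" by simp
  let ?\<pi> = "realization_map NH NK (col 0)" and ?\<iota> = "realization_map NK NH const"
  have 1: "homotopic_with (\<lambda>_. True) (nsphere j) (geometric_realization NH)
      (realization_map NH NH id \<circ> f) (?\<iota> \<circ> ?\<pi> \<circ> f)"
    by (rule homotopic_with_compose_continuous_map_right[OF id_homotopic_const_col f]) simp
  obtain c where "homotopic_with (\<lambda>_. True) (nsphere j) (geometric_realization NK) (?\<pi> \<circ> f) (\<lambda>_. c)"
    using low_dimensional_sphere_map_nullhomotopic[OF jm continuous_map_compose[OF f continuous_map_col]] by blast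
  then have "homotopic_with (\<lambda>_. True) (nsphere j) (geometric_realization NH) (?\<iota> \<circ> (?\<pi> \<circ> f)) (?\<iota> \<circ> (\<lambda>_. c))"
    by (rule homotopic_with_compose_continuous_map_left[OF _ continuous_map_const]) simp
  then have 2: "homotopic_with (\<lambda>_. True) (nsphere j) (geometric_realization NH) (?\<iota> \<circ> ?\<pi> \<circ> f) (\<lambda>_. ?\<iota> c)"
    by (simp add: o_def)
  obtain g where g: "continuous_map (nball (Suc j)) (geometric_realization NH) g"
    "\<forall>x\<in>topspace (nsphere j). g x = (realization_map NH NH id \<circ> f) x"
    using nullhomotopic_imp_extends_to_nball[OF homotopic_with_trans[OF 1 2]] by blast
  have "(realization_map NH NH id \<circ> f) x = f x" if "x \<in> topspace (nsphere j)" for x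
    using realization_map_cong_id[OF finite_Union_NH, of id "f x"] continuous_map_image_subset_topspace[OF f] that
    by (auto simp del: Union_iff)
  then show "\<exists>g. continuous_map (nball (Suc j)) (geometric_realization NH) g \<and> (\<forall>x\<in>topspace (nsphere j). g x = f x)"
    using g by (intro exI[of _ g]) simp
qed

text \<open>
  If \<open>\<iota>\<close> on the sphere of dimension \<open>n = m - 2\<close> extends to \<open>g\<close> on the ball, then \<open>\<pi> \<circ> g\<close> extends the
  identity of this sphere.
\<close>

lemma not_k_connected_NH:
  assumes "k_connected k (geometric_realization NH)"
  shows "k \<le> int m - 3"
proof (rule ccontr)
  assume k: "\<not> k \<le> int m - 3"
  define n where "n = m - 2"
  have mn: "m = n + 2" and nk: "int n \<le> k"
    using m k by (simp_all add: n_def)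
  let ?\<pi> = "realization_map NH NK (col 0)" and ?\<iota> = "realization_map NK NH const"
  have \<alpha>: "continuous_map (nsphere n) (geometric_realization NK) (sphere_to_boundary n)"
    using continuous_map_sphere_to_boundary[of n] by (simp only: mn)
  have \<beta>: "continuous_map (geometric_realization NK) (nsphere n) (boundary_to_sphere n)"
    using continuous_map_boundary_to_sphere[of n] by (simp only: mn)
  obtain g where g: "continuous_map (nball (Suc n)) (geometric_realization NH) g"
    and ext: "\<And>x. x \<in> topspace (nsphere n) \<Longrightarrow> g x = (?\<iota> \<circ> sphere_to_boundary n) x"
    using assms nk continuous_map_compose[OF \<alpha> continuous_map_const] unfolding k_connected_def by metis
  have "continuous_map (nball (Suc n)) (nsphere n) (boundary_to_sphere n \<circ> (?\<pi> \<circ> g))"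
    by (intro continuous_map_compose[OF _ \<beta>] continuous_map_compose[OF g] continuous_map_col)
  moreover have "(boundary_to_sphere n \<circ> (?\<pi> \<circ> g)) x = x" if x: "x \<in> topspace (nsphere n)" for x
  proof -
    have "sphere_to_boundary n x \<in> topspace (geometric_realization NK)"
      using continuous_map_image_subset_topspace[OF \<alpha>] x by blast
    then have "?\<pi> (g x) = sphere_to_boundary n x"
      by (simp only: ext[OF x] o_apply col_const_realization)
    then show ?thesis
      by (simp only: o_apply boundary_to_sphere_inverse[OF x])
  qed
  ultimately show False
    by (rule sphere_identity_not_extendable)
qed

lemma conn_NH: "conn (geometric_realization NH) = ereal (real_of_int (int m - 3))"
  unfolding conn_def
proof (rule cSup_eq_maximum)
  show "ereal (real_of_int (int m - 3)) \<in> {ereal (real_of_int k) |k. k_connected k (geometric_realization NH)}"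
    using k_connected_NH by blast
  fix x assume "x \<in> {ereal (real_of_int k) |k. k_connected k (geometric_realization NH)}"
  then obtain k where x: "x = ereal (real_of_int k)" and "k_connected k (geometric_realization NH)"
    by blast
  then show "x \<le> ereal (real_of_int (int m - 3))"
    unfolding x ereal_less_eq of_int_le_iff by (intro not_k_connected_NH)
qed

end

theorem corollary1p4:
  fixes T :: "'a pair_pre_digraph" and m r i :: nat and A :: "nat set"
  assumes "pair_graph T" and "Digraph_Component.connected (with_proj T)" and "property_P T"
    and "2 \<le> m" and "m \<le> chromatic_number T"
    and "r \<ge> 1" and "0 \<le> i" and "i \<le> r - 1" and "A = {0..i}"
  shows "pair_graph (exponential_graph (complete_graph m) (cone_graph T r A)) \<and>
    ereal (real (chromatic_number (exponential_graph (complete_graph m) (cone_graph T r A)))) =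
      conn (geometric_realization
        (neighborhood_complex (exponential_graph (complete_graph m) (cone_graph T r A)))) + 3"
proof -
  note dom = property_P_edge_dominates[OF assms(1-3)]
  obtain q where q: "q \<in> {1..m} \<rightarrow> pverts T"
      "\<forall>a\<in>{1..m}. \<forall>b\<in>{1..m}. a \<noteq> b \<longrightarrow> (q a, q b) \<in> parcs T"
    using clique_of_edge_dominating[OF assms(1,5) dom] by metis
  interpret dominated_cone T m r i q
  proof (rule dominated_cone.intro)
    show "i < r"
      using assms(6,8) by simp
    show "q a \<in> pverts T" if "a \<in> {1..m}" for a
      using q(1) that by (rule funcset_mem)
    show "(q a, q b) \<in> parcs T" if "a \<in> {1..m}" "b \<in> {1..m}" "a \<noteq> b" for a b
      using q(2) that by metis
    show "(x, z) \<in> parcs T \<or> (y, z) \<in> parcs T" if "(x, y) \<in> parcs T" "z \<in> pverts T" for x y z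
      using that by (rule dom)
  qed (fact assms)+
  have "conn (geometric_realization NH) + 3 = ereal (real m)"
    unfolding conn_NH using plus_ereal.simps(1)[of "real_of_int (int m - 3)" 3] by simp
  then show ?thesis
    unfolding assms(9) using pair_graph_H chromatic_number_H by simp
qed

end
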